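(* Let $Y$ be a metrisable $\sigma$-locally compact space, and let $f:\mathbb{R}^2\to Y$ be a function whose graph is closed in $\mathbb{R}^2\times Y$ and whose set $D_f$ of all points of discontinuity is a network. Then the graph of $f$ is disconnected.
   Context: $D_f$ is the set of points of $\mathbb{R}^2$ at which $f$ is not continuous. The graph of $f$ is $\{(x,f(x)):x\in\mathbb{R}^2\}$ with the subspace topology of the product $\mathbb{R}^2\times Y$. A space is $\sigma$-locally compact if it is locally compact and $\sigma$-compact (for metrisable $Y$ this is equivalent to the existence of a metric inducing the topology of $Y$ for which every bounded closed subset is compact). An arc is a set homeomorphic to $[0,1]$; the symbol $[a,b]$ (possibly with an index, $[a,b]_i$) denotes a chosen arc with endpoints $a$ and $b$. A set $E\subset\mathbb{R}^2$ is a network iff there are arcs $[a_1,b_1]_1,\dots,[a_n,b_n]_n\subset\mathbb{R}^2$ such that: (1) $E=\bigcup_{i=1}^n[a_i,b_i]_i$; (2) $[a_1,b_1]_1\cup[a_2,b_2]_2$ is homeomorphic to the unit circle; (3) $[a_k,b_k]_k\cap\bigcup_{i=1}^{k-1}[a_i,b_i]_i=\{a_k,b_k\}$ for $k=2,\dots,n$. *)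

theory Defs
  imports "HOL-Analysis.Analysis"
begin

definition sigma_compact_space :: "'b topology \<Rightarrow> bool" where
  "sigma_compact_space Y \<longleftrightarrow>
     (\<exists>\<K>. countable \<K> \<and> (\<forall>K\<in>\<K>. compactin Y K) \<and> \<Union>\<K> = topspace Y)"

definition sigma_locally_compact_space :: "'b topology \<Rightarrow> bool" where
  "sigma_locally_compact_space Y \<longleftrightarrow> locally_compact_space Y \<and> sigma_compact_space Y"

text \<open>The arc is a set here, not a path; its endpoints are the images of \<open>0\<close> and \<open>1\<close>
  under some homeomorphism from the unit interval.\<close>

definition arc_between :: "'a::topological_space set \<Rightarrow> 'a \<Rightarrow> 'a \<Rightarrow> bool" where
  "arc_between A a b \<longleftrightarrow>
     (\<exists>h k. homeomorphism {0..1::real} A h k \<and> h 0 = a \<and> h 1 = b)"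

text \<open>Indices start at \<open>1\<close>. The circle consists of the first two arcs, so \<open>n \<ge> 2\<close>.\<close>

definition network :: "(real^2) set \<Rightarrow> bool" where
  "network E \<longleftrightarrow>
     (\<exists>(n::nat) A a b. n \<ge> 2 \<and>
        (\<forall>i\<in>{1..n}. arc_between (A i) (a i) (b i)) \<and>
        E = (\<Union>i\<in>{1..n}. A i) \<and>
        (A 1 \<union> A 2) homeomorphic (sphere 0 1 :: (real^2) set) \<and>
        (\<forall>k\<in>{2..n}. A k \<inter> (\<Union>i\<in>{1..k-1}. A i) = {a k, b k}))"

definition discontinuity_set :: "'b topology \<Rightarrow> (real^2 \<Rightarrow> 'b) \<Rightarrow> (real^2) set" where
  "discontinuity_set Y f = {x. \<not> topcontinuous_at euclidean Y f x}"

definition fun_graph :: "(real^2 \<Rightarrow> 'b) \<Rightarrow> ((real^2) \<times> 'b) set" where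
  "fun_graph f = range (\<lambda>x. (x, f x))"

end

theory Submission
  imports Defs "HOL-Complex_Analysis.Contour_Integration"
begin

text \<open>The problem reduces to a real function. Since \<open>Y\<close> is locally compact, \<open>\<sigma>\<close>-compact and metrisable,
  it carries a continuous proper function \<open>\<rho> \<ge> 0\<close>. Then \<open>g = \<rho> \<circ> f\<close> again has a closed graph, this
  graph is a continuous image of the graph of \<open>f\<close>, and \<open>g\<close> is discontinuous exactly where \<open>f\<close> is.
  The plane is taken to be the complex plane, where Janiszewski's theorem and the Jordan curve
  theorem are stated. Let \<open>D\<close> be the network of discontinuities, and call the components of its
  complement faces.

  Because the graph is closed, the values of \<open>g\<close> along a sequence that converges to \<open>a\<close> can only
  accumulate at \<open>g a\<close> or at infinity. A network stays connected when a suitable small neighbourhood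
  of any one of its points is removed, because every ear is attached at both of its ends.
  Janiszewski's theorem turns this into local connectedness of the faces at their boundary, and so
  at a boundary point \<open>a\<close> of a face \<open>F\<close> the function \<open>g\<close> restricted to \<open>F\<close> tends either to \<open>g a\<close> or
  to infinity (\<open>face_limit_dichotomy\<close>). In the first case \<open>a\<close> is called tame for \<open>F\<close>. The graph over
  \<open>F\<close> together with its tame points is closed (\<open>closed_graph_face\<close>), and the tame points are open
  in the boundary of \<open>F\<close>. As \<open>g\<close> is discontinuous at every point of \<open>D\<close>, no point of \<open>D\<close> is tame for
  all the faces around it (\<open>not_all_sides_tame\<close>).

  The end of the argument is a count. Let \<open>V\<close> be the set of endpoints of the arcs; it cuts the
  network into edges. The faces and the vertices are to be coloured with two colours such that
  each colour class, completed by suitable parts of the edges, has a closed graph. This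
  imposes two kinds of constraints: a vertex that is tame for a face has the colour of that face,
  and the ends of an edge have the same colour if the graph over the edge cannot be cut
  between them. A constraint of the first kind occupies at least two edge ends, one of the second
  kind occupies both ends of its edge, and no edge end is occupied twice; so there are at most as
  many constraints as edges (\<open>card_constraints\<close>). By Euler's inequality the number of edges is at
  least two less than the number of vertices and faces (\<open>card_edges_less\<close>): each ear beyond the
  circle adds a new face. With so few constraints some colouring uses both colours
  (\<open>exists_proper_closed_class\<close>), and it splits the graph of \<open>g\<close> into two disjoint nonempty closed
  sets.\<close>

section \<open>Colourings under few constraints\<close>

text \<open>A graph with \<open>N\<close> nodes and at most \<open>N - 2\<close> edges is disconnected: contracting an edge
  lowers both numbers by one and does not change the number of components.\<close>

lemma exists_proper_closed_class:
  assumes "finite S" "finite R" "R \<subseteq> S \<times> S" "card R + 2 \<le> card S"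
  shows "\<exists>X. X \<subseteq> S \<and> X \<noteq> {} \<and> X \<noteq> S \<and> (\<forall>(x,y)\<in>R. x \<in> X \<longleftrightarrow> y \<in> X)"
  using assms(2,1,3,4)
proof (induction R arbitrary: S rule: measure_induct_rule[where f=card])
  case (less R)
  show ?case
  proof (cases "R = {}")
    case True
    then obtain x where "x \<in> S" using less.prems by fastforce
    moreover have "S \<noteq> {x}" using less.prems by auto
    ultimately show ?thesis using True by blast
  next
    case False
    then obtain x y where xy: "(x,y) \<in> R" by auto
    show ?thesis
    proof (cases "x = y")
      case True
      have "card (R - {(x,y)}) < card R"
        using xy less.prems by (meson card_Diff1_less)
      with less.IH[of "R - {(x,y)}" S] less.prems obtain X where
        "X \<subseteq> S" "X \<noteq> {}" "X \<noteq> S" "\<forall>(x,y)\<in>R - {(x,y)}. x \<in> X \<longleftrightarrow> y \<in> X"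
        by (auto simp: subset_iff)
      then show ?thesis using True by (intro exI[of _ X]) fast
    next
      case False
      define m where "m z = (if z = y then x else z)" for z
      define R' where "R' = map_prod m m ` (R - {(x,y)})"
      have xS: "x \<in> S" "y \<in> S" using xy less.prems by auto
      have fR: "finite R'" using less.prems by (simp add: R'_def)
      have "card R' \<le> card (R - {(x,y)})"
        unfolding R'_def using less.prems by (intro card_image_le) auto
      moreover have "card (R - {(x,y)}) + 1 = card R"
        using xy less.prems(1,2) by (metis card_Suc_Diff1 Suc_eq_plus1)
      moreover have "card (S - {y}) + 1 = card S"
        using xS less.prems(1,2) by (metis card_Suc_Diff1 Suc_eq_plus1)
      ultimately have c: "card R' < card R" "card R' + 2 \<le> card (S - {y})"
        using less.prems by auto
      have R'S: "R' \<subseteq> (S - {y}) \<times> (S - {y})"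
      proof
        fix p assume "p \<in> R'"
        then obtain u v where uv: "(u,v) \<in> R" "p = (m u, m v)" by (auto simp: R'_def)
        then have "u \<in> S" "v \<in> S" using less.prems(3) by blast+
        then show "p \<in> (S - {y}) \<times> (S - {y})" using uv(2) xS False by (simp add: m_def)
      qed
      have fS: "finite (S - {y})" using less.prems by simp
      from less.IH[OF c(1) fR fS R'S c(2)] obtain X where
        X: "X \<subseteq> S - {y}" "X \<noteq> {}" "X \<noteq> S - {y}" "\<forall>(u,v)\<in>R'. u \<in> X \<longleftrightarrow> v \<in> X"
        by (elim exE conjE) (rule that)
      \<comment> \<open>Undo the contraction: \<open>y\<close> joins the class of \<open>x\<close>.\<close>
      define X' where "X' = {z\<in>S. m z \<in> X}"
      have "u \<in> X' \<longleftrightarrow> v \<in> X'" if "(u,v) \<in> R" for u v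
      proof (cases "(u,v) = (x,y)")
        case True
        then show ?thesis using xS by (auto simp: X'_def m_def)
      next
        case F: False
        then have "(m u, m v) \<in> R'" using that unfolding R'_def by force
        with X(4) have "m u \<in> X \<longleftrightarrow> m v \<in> X" by blast
        then show ?thesis using that less.prems by (auto simp: X'_def)
      qed
      moreover have "z \<in> X' \<longleftrightarrow> z \<in> X" if "z \<in> S - {y}" for z
        using that by (simp add: X'_def m_def)
      moreover have "X' \<subseteq> S" by (auto simp: X'_def)
      ultimately show ?thesis
        using X(1-3) by (intro exI[of _ X']) blast
    qed
  qed
qed

section \<open>Local connectedness of planar complements\<close>

text \<open>Janiszewski's theorem is applied to \<open>S\<close> and to the union of \<open>K\<close> with the exterior of the ball.
  These two sets meet exactly in the connected set \<open>K\<close>, and neither separates two nearby points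
  of one component of the complement of \<open>S\<close>.\<close>

lemma connected_near_nonseparating_point:
  fixes S K :: "complex set"
  assumes "compact S" "compact K" "connected K" "K \<subseteq> S" "a \<notin> K" "S - K \<subseteq> ball a \<epsilon>" "0 < \<epsilon>"
  shows "\<exists>\<delta>>0. \<forall>y z. y \<in> ball a \<delta> \<longrightarrow> z \<in> ball a \<delta> \<longrightarrow> connected_component (- S) y z \<longrightarrow>
           connected_component (ball a \<epsilon> - S) y z"
proof -
  have "open (- K)" using assms by (simp add: compact_imp_closed open_Compl)
  then obtain r where r: "r > 0" "ball a r \<subseteq> - K"
    using assms by (meson ComplI open_contains_ball)
  define \<delta> where "\<delta> = min r \<epsilon>"
  let ?T = "K \<union> - ball a \<epsilon>"
  have "connected_component (ball a \<epsilon> - S) y z"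
    if yz: "y \<in> ball a \<delta>" "z \<in> ball a \<delta>" "connected_component (- S) y z" for y z
  proof -
    have "S \<inter> ?T = K" using assms by auto
    moreover have "connected_component (- ?T) y z"
      unfolding connected_component_def
      by (rule exI[of _ "ball a \<delta>"]) (use yz r in \<open>auto simp: \<delta>_def\<close>)
    moreover have "closed ?T" using assms(2) by (intro closed_Un compact_imp_closed closed_Compl open_ball)
    ultimately have "connected_component (- (S \<union> ?T)) y z"
      using Janiszewski[of S ?T y z] assms yz by simp
    moreover have "- (S \<union> ?T) = ball a \<epsilon> - S" using assms by auto
    ultimately show ?thesis by simp
  qed
  moreover have "\<delta> > 0" using r assms by (simp add: \<delta>_def)
  ultimately show ?thesis by blast
qed

text \<open>Asking for a compact connected \<open>K\<close> whose complement in \<open>S\<close> is small, rather than for a small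
  neighbourhood that can be removed, is the form in which the property enters Janiszewski's
  theorem. Circles have it at every point, arcs only at their two ends.\<close>

definition small_connected_complement :: "complex set \<Rightarrow> complex \<Rightarrow> bool" where
  "small_connected_complement S a \<longleftrightarrow>
     (\<forall>\<epsilon>>0. \<exists>K. compact K \<and> connected K \<and> K \<subseteq> S \<and> a \<notin> K \<and> S - K \<subseteq> ball a \<epsilon>)"

lemma locally_connected_near:
  assumes "compact S" "small_connected_complement S a" "0 < \<epsilon>"
  obtains \<delta> where "0 < \<delta>" "\<delta> \<le> \<epsilon>"
    "\<And>y z. y \<in> ball a \<delta> \<Longrightarrow> z \<in> ball a \<delta> \<Longrightarrow> connected_component (- S) y z \<Longrightarrow>
           connected_component (ball a \<epsilon> - S) y z"
proof -
  obtain K where "compact K" "connected K" "K \<subseteq> S" "a \<notin> K" "S - K \<subseteq> ball a \<epsilon>"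
    using assms unfolding small_connected_complement_def by blast
  from connected_near_nonseparating_point[OF assms(1) this assms(3)]
  obtain d where d: "d > 0" "\<forall>y z. y \<in> ball a d \<longrightarrow> z \<in> ball a d \<longrightarrow> connected_component (- S) y z \<longrightarrow>
           connected_component (ball a \<epsilon> - S) y z" by auto
  show ?thesis by (rule that[of "min d \<epsilon>"]) (use d assms in auto)
qed

lemma path_ends_near:
  fixes g :: "real \<Rightarrow> 'a::metric_space"
  assumes "path g" "0 < \<epsilon>"
  obtains \<eta> where "0 < \<eta>" "\<eta> < 1/2" "\<And>t. 0 \<le> t \<Longrightarrow> t \<le> \<eta> \<Longrightarrow> g t \<in> ball (g 0) \<epsilon>"
    "\<And>t. 1 - \<eta> \<le> t \<Longrightarrow> t \<le> 1 \<Longrightarrow> g t \<in> ball (g 1) \<epsilon>"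
proof -
  have "uniformly_continuous_on {0..1} g"
    using assms unfolding path_def by (intro compact_uniformly_continuous) auto
  then obtain d where d: "d > 0" "\<And>x y. x \<in> {0..1} \<Longrightarrow> y \<in> {0..1} \<Longrightarrow> dist x y < d \<Longrightarrow> dist (g x) (g y) < \<epsilon>"
    using assms unfolding uniformly_continuous_on_def by metis
  show ?thesis
    by (rule that[of "min (d/2) (1/4)"]) (use d in \<open>auto simp: dist_real_def intro!: d(2)\<close>)
qed

lemma connected_path_segment:
  assumes "path g" "0 \<le> s" "t \<le> 1"
  shows "compact (g ` {s..t})" "connected (g ` {s..t})"
proof -
  have "continuous_on {s..t} g"
    using assms unfolding path_def by (rule_tac continuous_on_subset) auto
  then show "compact (g ` {s..t})" "connected (g ` {s..t})"
    by (auto intro: compact_continuous_image connected_continuous_image)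
qed

text \<open>The parametrisation is shifted so that it starts and ends at \<open>a\<close>; its middle part then serves
  as \<open>K\<close>.\<close>

lemma small_connected_complement_circle:
  assumes "simple_path c" "pathfinish c = pathstart c" "a \<in> path_image c"
  shows "small_connected_complement (path_image c) a"
  unfolding small_connected_complement_def
proof (intro allI impI)
  fix \<epsilon> :: real assume "\<epsilon> > 0"
  obtain s where s: "s \<in> {0..1}" "a = c s" using assms(3) by (auto simp: path_image_def)
  define g where "g = shiftpath s c"
  have g: "simple_path g" "pathfinish g = pathstart g" "path_image g = path_image c" "g 0 = a"
    using assms s simple_path_shiftpath[of c s] path_image_shiftpath[of s c]
      endpoints_shiftpath[of c s]
    by (auto simp: g_def) (simp add: shiftpath_def)
  then have g1: "g 1 = a" by (simp add: pathfinish_def pathstart_def)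
  obtain \<eta> where \<eta>: "0 < \<eta>" "\<eta> < 1/2" "\<And>t. 0 \<le> t \<Longrightarrow> t \<le> \<eta> \<Longrightarrow> g t \<in> ball (g 0) \<epsilon>"
    "\<And>t. 1 - \<eta> \<le> t \<Longrightarrow> t \<le> 1 \<Longrightarrow> g t \<in> ball (g 1) \<epsilon>"
    using path_ends_near[OF simple_path_imp_path[OF g(1)] \<open>\<epsilon> > 0\<close>] by blast
  let ?K = "g ` {\<eta>..1-\<eta>}"
  have "a \<notin> ?K"
  proof
    assume "a \<in> ?K"
    then obtain t where "t \<in> {\<eta>..1-\<eta>}" "g t = g 0" using g by auto
    moreover have "t \<in> {0..1}" using \<open>t \<in> {\<eta>..1-\<eta>}\<close> \<eta> by auto
    moreover have "(0::real) \<in> {0..1}" by simp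
    ultimately have "t = 0 \<or> t = 1" using g(1) unfolding simple_path_def loop_free_def by blast
    with \<open>t \<in> {\<eta>..1-\<eta>}\<close> \<eta> show False by auto
  qed
  moreover have "path_image c - ?K \<subseteq> ball a \<epsilon>"
  proof
    fix x assume x: "x \<in> path_image c - ?K"
    then obtain t where t: "t \<in> {0..1}" "x = g t" using g(3) unfolding path_image_def by blast
    with x have "t \<notin> {\<eta>..1-\<eta>}" by blast
    with t \<eta>(3)[of t] \<eta>(4)[of t] show "x \<in> ball a \<epsilon>" using g(4) g1 by auto
  qed
  moreover have "?K \<subseteq> path_image c" using g(3) \<eta> by (auto simp: path_image_def)
  ultimately show "\<exists>K. compact K \<and> connected K \<and> K \<subseteq> path_image c \<and> a \<notin> K \<and> path_image c - K \<subseteq> ball a \<epsilon>"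
    using connected_path_segment[OF simple_path_imp_path[OF g(1)], of \<eta> "1-\<eta>"] \<eta> by (intro exI[of _ ?K]) auto
qed

lemma small_connected_complement_arc_start:
  assumes "arc g"
  shows "small_connected_complement (path_image g) (pathstart g)"
  unfolding small_connected_complement_def
proof (intro allI impI)
  fix \<epsilon> :: real assume "\<epsilon> > 0"
  obtain \<eta> where \<eta>: "0 < \<eta>" "\<eta> < 1/2" "\<And>t. 0 \<le> t \<Longrightarrow> t \<le> \<eta> \<Longrightarrow> g t \<in> ball (g 0) \<epsilon>"
    "\<And>t. 1 - \<eta> \<le> t \<Longrightarrow> t \<le> 1 \<Longrightarrow> g t \<in> ball (g 1) \<epsilon>"
    using path_ends_near[OF arc_imp_path[OF assms] \<open>\<epsilon> > 0\<close>] by blast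
  let ?K = "g ` {\<eta>..1}"
  have "pathstart g \<notin> ?K"
  proof
    assume "pathstart g \<in> ?K"
    then obtain t where t: "t \<in> {\<eta>..1}" "g t = g 0" by (auto simp: pathstart_def)
    have "inj_on g {0..1}" using assms by (simp add: arc_def)
    from inj_onD[OF this t(2)] t \<eta> show False by auto
  qed
  moreover have "path_image g - ?K \<subseteq> ball (pathstart g) \<epsilon>"
    using \<eta> by (force simp: path_image_def pathstart_def)
  moreover have "?K \<subseteq> path_image g" using \<eta> by (auto simp: path_image_def)
  ultimately show "\<exists>K. compact K \<and> connected K \<and> K \<subseteq> path_image g \<and> pathstart g \<notin> K \<and> path_image g - K \<subseteq> ball (pathstart g) \<epsilon>"
    using connected_path_segment[OF arc_imp_path[OF assms], of \<eta> 1] \<eta> by (intro exI[of _ ?K]) auto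
qed

text \<open>The property survives the attachment of an arc at both of its ends. At an interior point of
  the ear, the two remaining pieces of the ear still hang on \<open>S\<close>. At an attachment point, the part
  of \<open>S\<close> and the part of the ear that remain are joined through the other attachment point.\<close>

lemma small_connected_complement_ear:
  assumes S: "compact S" "connected S" "\<And>a. a \<in> S \<Longrightarrow> small_connected_complement S a"
    and g: "arc g" "path_image g \<inter> S = {pathstart g, pathfinish g}"
    and a: "a \<in> S \<union> path_image g"
  shows "small_connected_complement (S \<union> path_image g) a"
proof -
  have at_start: "small_connected_complement (S \<union> path_image h) (pathstart h)"
    if h: "arc h" "path_image h \<inter> S = {pathstart h, pathfinish h}" for h
    unfolding small_connected_complement_def
  proof (intro allI impI)
    fix \<epsilon> :: real assume e: "\<epsilon> > 0"
    let ?a = "pathstart h" and ?b = "pathfinish h"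
    have ab: "?a \<noteq> ?b" using h arc_distinct_ends by metis
    \<comment> \<open>The radius leaves out the other end \<open>?b\<close>, which has to lie on both remaining parts.\<close>
    define e where "e = min \<epsilon> (dist ?a ?b)"
    have e0: "e > 0" using e ab by (simp add: e_def)
    obtain K where K: "compact K" "connected K" "K \<subseteq> S" "?a \<notin> K" "S - K \<subseteq> ball ?a e"
      using S(3)[of ?a] h(2) e0 unfolding small_connected_complement_def by blast
    obtain L where L: "compact L" "connected L" "L \<subseteq> path_image h" "?a \<notin> L" "path_image h - L \<subseteq> ball ?a e"
      using small_connected_complement_arc_start[OF h(1)] e0 unfolding small_connected_complement_def by blast
    have "?b \<in> K" using K(5) h(2) by (auto simp: e_def)
    moreover have "?b \<in> L" using L(5) by (auto simp: e_def dest!: subsetD[of _ _ ?b])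
    ultimately have "connected (K \<union> L)" using K L by (intro connected_Un) auto
    moreover have "S \<union> path_image h - (K \<union> L) \<subseteq> ball ?a \<epsilon>"
      using K(5) L(5) by (auto simp: e_def)
    ultimately show "\<exists>K. compact K \<and> connected K \<and> K \<subseteq> S \<union> path_image h \<and> ?a \<notin> K \<and> S \<union> path_image h - K \<subseteq> ball ?a \<epsilon>"
      using K L by (intro exI[of _ "K \<union> L"]) auto
  qed
  consider "a = pathstart g" | "a = pathfinish g" | "a \<in> S" "a \<notin> path_image g" | "a \<in> path_image g" "a \<notin> S"
    using a g by blast
  then show ?thesis
  proof cases
    case 1 then show ?thesis using at_start g by simp
  next
    case 2
    have "small_connected_complement (S \<union> path_image (reversepath g)) (pathstart (reversepath g))"
      by (rule at_start) (use g in \<open>auto simp: arc_reversepath\<close>)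
    then show ?thesis using 2 by simp
  next
    case 3
    show ?thesis unfolding small_connected_complement_def
    proof (intro allI impI)
      fix \<epsilon> :: real assume e: "\<epsilon> > 0"
      have "a \<in> - path_image g" "open (- path_image g)"
        using 3 g by (auto simp: closed_arc_image open_Compl)
      then obtain r where r: "r > 0" "ball a r \<subseteq> - path_image g" by (meson open_contains_ball)
      define e where "e = min \<epsilon> r"
      have e0: "e > 0" using e r by (simp add: e_def)
      obtain K where K: "compact K" "connected K" "K \<subseteq> S" "a \<notin> K" "S - K \<subseteq> ball a e"
        using S(3)[OF 3(1)] e0 unfolding small_connected_complement_def by blast
      have "pathstart g \<in> K"
      proof (rule ccontr)
        assume "pathstart g \<notin> K"
        then have "pathstart g \<in> ball a e" using K g by blast
        then have "pathstart g \<in> - path_image g" using r by (auto simp: e_def)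
        then show False using pathstart_in_path_image by blast
      qed
      then have "connected (K \<union> path_image g)"
        using K g by (intro connected_Un) (auto simp: connected_arc_image)
      then show "\<exists>K. compact K \<and> connected K \<and> K \<subseteq> S \<union> path_image g \<and> a \<notin> K \<and> S \<union> path_image g - K \<subseteq> ball a \<epsilon>"
        using K 3 g by (intro exI[of _ "K \<union> path_image g"]) (auto simp: e_def compact_arc_image)
    qed
  next
    case 4
    show ?thesis unfolding small_connected_complement_def
    proof (intro allI impI)
      fix \<epsilon> :: real assume e: "\<epsilon> > 0"
      obtain t where t: "t \<in> {0..1}" "a = g t" using 4 by (auto simp: path_image_def)
      have "a \<noteq> g 0" "a \<noteq> g 1" using 4 g by (auto simp: pathstart_def pathfinish_def)
      then have t01: "0 < t" "t < 1" using t by (auto simp: less_le)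
      have "continuous_on {0..1} g" using g by (simp add: arc_def path_def)
      then obtain d where d: "d > 0" "\<And>x. x \<in> {0..1} \<Longrightarrow> dist x t < d \<Longrightarrow> dist (g x) (g t) < \<epsilon>"
        using t e unfolding continuous_on_iff by metis
      define h where "h = min (d/2) (min (t/2) ((1-t)/2))"
      have h: "h > 0" "h < d" "h < t" "h < 1 - t" using d(1) t01 by (simp_all add: h_def min_def field_simps)
      let ?L1 = "g ` {0..t-h}" and ?L2 = "g ` {t+h..1}"
      have inj: "inj_on g {0..1}" using g by (simp add: arc_def)
      have "r = t" if "r \<in> {0..1}" "g r = a" for r
        using inj_onD[OF inj, of r t] that t by simp
      then have "a \<notin> g ` T" if "T \<subseteq> {0..1}" "t \<notin> T" for T
        using that by blast
      from this[of "{0..t-h}"] this[of "{t+h..1}"] h t01 have "a \<notin> ?L1" "a \<notin> ?L2" by auto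
      moreover have "connected (?L1 \<union> (S \<union> ?L2))"
      proof (rule connected_Un)
        show "connected ?L1" by (rule connected_path_segment) (use g h t01 in \<open>auto simp: arc_imp_path\<close>)
        show "connected (S \<union> ?L2)"
        proof (rule connected_Un)
          show "connected ?L2" by (rule connected_path_segment) (use g h t01 in \<open>auto simp: arc_imp_path\<close>)
          have "pathfinish g \<in> S \<inter> ?L2" using g(2) h by (auto simp: pathfinish_def)
          then show "S \<inter> ?L2 \<noteq> {}" by blast
        qed fact
        have "pathstart g \<in> ?L1 \<inter> (S \<union> ?L2)" using g(2) h by (auto simp: pathstart_def)
        then show "?L1 \<inter> (S \<union> ?L2) \<noteq> {}" by blast
      qed
      moreover have "compact (?L1 \<union> (S \<union> ?L2))"
        using connected_path_segment(1)[OF arc_imp_path[OF g(1)], of 0 "t-h"]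
          connected_path_segment(1)[OF arc_imp_path[OF g(1)], of "t+h" 1] h t01 S by (intro compact_Un) auto
      moreover have "S \<union> path_image g - (?L1 \<union> (S \<union> ?L2)) \<subseteq> ball a \<epsilon>"
      proof
        fix x assume x: "x \<in> S \<union> path_image g - (?L1 \<union> (S \<union> ?L2))"
        then obtain s where s: "s \<in> {0..1}" "x = g s" by (auto simp: path_image_def)
        with x have "s \<notin> {0..t-h}" "s \<notin> {t+h..1}" by auto
        with s h have "dist s t < d" by (auto simp: dist_real_def)
        with d(2)[OF s(1)] show "x \<in> ball a \<epsilon>" using s t by (simp add: dist_commute)
      qed
      moreover have "?L1 \<union> (S \<union> ?L2) \<subseteq> S \<union> path_image g" using h t01 by (auto simp: path_image_def)
      ultimately show "\<exists>K. compact K \<and> connected K \<and> K \<subseteq> S \<union> path_image g \<and> a \<notin> K \<and> S \<union> path_image g - K \<subseteq> ball a \<epsilon>"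
        using 4 by (intro exI[of _ "?L1 \<union> (S \<union> ?L2)"]) auto
    qed
  qed
qed

section \<open>Ears and the components of the complement\<close>

text \<open>The Jordan curve theorem in the pointwise form used below.\<close>

lemma Jordan_sides:
  fixes c :: "real \<Rightarrow> complex"
  assumes "simple_path c" "pathfinish c = pathstart c"
  shows "connected_component (- path_image c) y z \<Longrightarrow> y \<in> inside (path_image c) \<Longrightarrow> z \<notin> outside (path_image c)"
    and "x \<in> path_image c \<Longrightarrow> 0 < r \<Longrightarrow> \<exists>y. y \<in> inside (path_image c) \<inter> ball x r"
    and "x \<in> path_image c \<Longrightarrow> 0 < r \<Longrightarrow> \<exists>y. y \<in> outside (path_image c) \<inter> ball x r"
    and "y \<in> inside (path_image c) \<Longrightarrow> z \<in> inside (path_image c) \<Longrightarrow> connected_component (- path_image c) y z"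
    and "y \<in> outside (path_image c) \<Longrightarrow> z \<in> outside (path_image c) \<Longrightarrow> connected_component (- path_image c) y z"
    and "y \<notin> path_image c \<Longrightarrow> y \<in> inside (path_image c) \<or> y \<in> outside (path_image c)"
    and "y \<in> inside (path_image c) \<Longrightarrow> y \<notin> path_image c"
    and "y \<in> outside (path_image c) \<Longrightarrow> y \<notin> path_image c"
proof -
  note J = Jordan_inside_outside[OF assms]
  have U: "inside (path_image c) \<union> outside (path_image c) = - path_image c" using J by blast
  have near: "\<exists>y. y \<in> S \<inter> ball x r" if "x \<in> frontier S" and r: "0 < r" for S x r
  proof -
    have "x \<in> closure S" using that by (simp add: frontier_def)
    then obtain y where "y \<in> S" "dist y x < r" using r closure_approachable[of x S] by blast
    then have "y \<in> S \<inter> ball x r" by (simp add: dist_commute)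
    then show ?thesis ..
  qed
  show "x \<in> path_image c \<Longrightarrow> 0 < r \<Longrightarrow> \<exists>y. y \<in> inside (path_image c) \<inter> ball x r"
    and "x \<in> path_image c \<Longrightarrow> 0 < r \<Longrightarrow> \<exists>y. y \<in> outside (path_image c) \<inter> ball x r"
    using J near[of x "inside (path_image c)" r] near[of x "outside (path_image c)" r] by simp_all
  show "y \<notin> path_image c \<Longrightarrow> y \<in> inside (path_image c) \<or> y \<in> outside (path_image c)"
    and "y \<in> inside (path_image c) \<Longrightarrow> y \<notin> path_image c"
    and "y \<in> outside (path_image c) \<Longrightarrow> y \<notin> path_image c"
    using U by blast+
  show "y \<in> inside (path_image c) \<Longrightarrow> z \<in> inside (path_image c) \<Longrightarrow> connected_component (- path_image c) y z"
    unfolding connected_component_def using J U by (intro exI[of _ "inside (path_image c)"]) blast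
  show "y \<in> outside (path_image c) \<Longrightarrow> z \<in> outside (path_image c) \<Longrightarrow> connected_component (- path_image c) y z"
    unfolding connected_component_def using J U by (intro exI[of _ "outside (path_image c)"]) blast
  show "z \<notin> outside (path_image c)" if yz: "connected_component (- path_image c) y z" "y \<in> inside (path_image c)"
  proof
    assume z: "z \<in> outside (path_image c)"
    obtain T where T: "connected T" "T \<subseteq> - path_image c" "y \<in> T" "z \<in> T"
      using yz by (auto simp: connected_component_def)
    have "inside (path_image c) \<inter> T = {} \<or> outside (path_image c) \<inter> T = {}"
    proof (rule connectedD[OF T(1)])
      show "T \<subseteq> inside (path_image c) \<union> outside (path_image c)" using U T by blast
    qed (use J in simp_all)
    then show False using T z yz by blast
  qed
qed

text \<open>The ear is closed up by an arc inside \<open>S\<close>.\<close>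

lemma ear_in_Jordan_curve:
  fixes g :: "real \<Rightarrow> complex"
  assumes "path_connected S" "arc g" "path_image g \<inter> S = {pathstart g, pathfinish g}"
  obtains c where "simple_path c" "pathfinish c = pathstart c" "path_image g \<subseteq> path_image c"
    "path_image c \<subseteq> S \<union> path_image g"
proof -
  have "pathfinish g \<in> S" "pathstart g \<in> S" "pathfinish g \<noteq> pathstart g"
    using assms arc_distinct_ends by (auto dest: arc_distinct_ends)
  then obtain b where b: "arc b" "path_image b \<subseteq> S" "pathstart b = pathfinish g" "pathfinish b = pathstart g"
    using assms(1) unfolding path_connected_arcwise by blast
  have "simple_path (g +++ b)"
    using assms b by (intro simple_path_join_loop) auto
  moreover have "path_image (g +++ b) = path_image g \<union> path_image b"
    using b by (simp add: path_image_join)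
  ultimately show ?thesis using b that[of "g +++ b"] by auto
qed

lemma component_containing:
  assumes "C \<in> components A" "A \<subseteq> B"
  obtains F where "F \<in> components B" "C \<subseteq> F"
proof -
  obtain x where x: "x \<in> A" "C = connected_component_set A x" using assms by (auto simp: components_iff)
  have "C \<subseteq> connected_component_set B x" using x assms connected_component_mono by blast
  then show ?thesis using that[of "connected_component_set B x"] x assms by (auto simp: components_iff)
qed

text \<open>A component of the new complement lies in a unique component of the old one. The resulting map
  is onto, since an arc has no interior, but not injective: the ear lies on a Jordan curve inside
  the enlarged set, and near the middle of the ear both sides of that curve are reached from one
  old component.\<close>

lemma card_components_ear:
  fixes S :: "complex set"
  assumes S: "compact S" "path_connected S"
    and g: "arc g" "path_image g \<inter> S = {pathstart g, pathfinish g}"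
    and fin: "finite (components (- (S \<union> path_image g)))"
  shows "finite (components (- S))" "card (components (- S)) < card (components (- (S \<union> path_image g)))"
proof -
  obtain c where c: "simple_path c" "pathfinish c = pathstart c" "path_image g \<subseteq> path_image c"
    "path_image c \<subseteq> S \<union> path_image g"
    using ear_in_Jordan_curve[OF S(2) g] by blast
  note J = Jordan_sides[OF c(1,2)]
  let ?A = "- (S \<union> path_image g)"
  \<comment> \<open>\<open>\<phi>\<close> maps a component of the new complement to the old component that contains it.\<close>
  define \<phi> where "\<phi> C = (SOME F. F \<in> components (- S) \<and> C \<subseteq> F)" for C
  have \<phi>: "\<phi> C \<in> components (- S) \<and> C \<subseteq> \<phi> C" if "C \<in> components ?A" for C
    unfolding \<phi>_def by (rule someI_ex) (use component_containing[OF that, of "- S"] in blast)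
  have \<phi>_eq: "\<phi> C = F" if "C \<in> components ?A" "F \<in> components (- S)" "x \<in> C" "x \<in> F" for C F x
    using \<phi>[OF that(1)] that components_nonoverlap[of "\<phi> C" "- S" F] by blast
  have opn: "open F" if "F \<in> components (- S)" for F
    using that S by (meson compact_imp_closed open_Compl open_components)
  have comp: "connected_component_set ?A x \<in> components ?A \<and> x \<in> connected_component_set ?A x"
    if "x \<in> ?A" for x using that by (auto simp: components_iff)
  have surj: "components (- S) = \<phi> ` components ?A"
  proof
    show "components (- S) \<subseteq> \<phi> ` components ?A"
    proof
      fix F assume F: "F \<in> components (- S)"
      then obtain x where x: "x \<in> F" using in_components_nonempty by blast
      obtain r where r: "r > 0" "ball x r \<subseteq> F" using opn[OF F] x by (meson open_contains_ball)
      \<comment> \<open>An arc of a Jordan curve cannot fill the open set \<open>F\<close>.\<close>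
      have "\<exists>y\<in>F. y \<notin> path_image g"
      proof (cases "x \<in> path_image g")
        case True
        then obtain y where "y \<in> inside (path_image c)" "y \<in> ball x r" using J(2)[of x r] c r by blast
        then show ?thesis using r J(7)[of y] c by blast
      qed (use x in blast)
      then obtain y where y: "y \<in> F" "y \<notin> path_image g" by blast
      then have "y \<in> ?A" using in_components_subset[OF F] by blast
      then show "F \<in> \<phi> ` components ?A" using comp[of y] \<phi>_eq[OF _ F _ y(1)] by (metis imageI)
    qed
  qed (use \<phi> in blast)
  show fS: "finite (components (- S))" unfolding surj using fin by simp
  have "\<not> inj_on \<phi> (components ?A)"
  proof
    assume inj: "inj_on \<phi> (components ?A)"
    let ?m = "g (1/2)"
    have inj_g: "inj_on g {0..1}" using g by (simp add: arc_def)
    have "g (1/2) \<noteq> g 0" "g (1/2) \<noteq> g 1"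
      using inj_onD[OF inj_g, of "1/2" 0] inj_onD[OF inj_g, of "1/2" 1] by auto
    moreover have m: "?m \<in> path_image g" by (auto simp: path_image_def)
    ultimately have "?m \<in> - S" using g by (auto simp: pathstart_def pathfinish_def)
    then obtain F where F: "F \<in> components (- S)" "?m \<in> F" by (metis UnionE Union_components)
    then obtain r where r: "r > 0" "ball ?m r \<subseteq> F" using opn by (meson open_contains_ball)
    obtain y z where y: "y \<in> inside (path_image c)" "y \<in> ball ?m r"
      and z: "z \<in> outside (path_image c)" "z \<in> ball ?m r"
      using J(2)[of ?m r] J(3)[of ?m r] m c r by blast
    have yF: "y \<in> F" and zF: "z \<in> F" using y z r by auto
    have "y \<in> ?A" "z \<in> ?A" using yF zF in_components_subset[OF F(1)] J(7)[OF y(1)] J(8)[OF z(1)] c by auto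
    note Cy = comp[OF this(1)] and Cz = comp[OF this(2)]
    have "\<phi> (connected_component_set ?A y) = \<phi> (connected_component_set ?A z)"
      using \<phi>_eq[OF _ F(1) _ yF] \<phi>_eq[OF _ F(1) _ zF] Cy Cz by metis
    with inj Cy Cz have "connected_component_set ?A y = connected_component_set ?A z"
      by (meson inj_onD)
    then have "connected_component ?A y z" using Cz by blast
    then have "connected_component (- path_image c) y z"
      by (rule connected_component_of_subset) (use c in auto)
    then show False using J(1) y z by blast
  qed
  then have "card (\<phi> ` components ?A) \<noteq> card (components ?A)"
    using fin eq_card_imp_inj_on by blast
  then show "card (components (- S)) < card (components ?A)"
    unfolding surj using card_image_le[OF fin, of \<phi>] by linarith
qed

section \<open>Networks in the complex plane\<close>

text \<open>A network with its arcs parametrised; arcs and vertices can then be addressed by times in the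
  unit interval.\<close>

locale ear_network =
  fixes n :: nat and \<gamma> :: "nat \<Rightarrow> real \<Rightarrow> complex"
  assumes two_le: "2 \<le> n"
    and arcs: "k \<in> {1..n} \<Longrightarrow> arc (\<gamma> k)"
    and base_circle: "\<exists>c. simple_path c \<and> pathfinish c = pathstart c \<and>
                       path_image c = path_image (\<gamma> 1) \<union> path_image (\<gamma> 2)"
    and ears: "k \<in> {2..n} \<Longrightarrow> path_image (\<gamma> k) \<inter> (\<Union>i\<in>{1..k-1}. path_image (\<gamma> i)) =
                  {pathstart (\<gamma> k), pathfinish (\<gamma> k)}"
begin

definition stage :: "nat \<Rightarrow> complex set" where
  "stage k = (\<Union>i\<in>{1..k}. path_image (\<gamma> i))"

abbreviation "D \<equiv> stage n"

lemma stage_Suc: "stage (Suc k) = stage k \<union> path_image (\<gamma> (Suc k))"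
  by (simp add: stage_def atLeastAtMostSuc_conv Un_commute)

lemma ear_stage: "2 \<le> Suc k \<Longrightarrow> Suc k \<le> n \<Longrightarrow>
    path_image (\<gamma> (Suc k)) \<inter> stage k = {pathstart (\<gamma> (Suc k)), pathfinish (\<gamma> (Suc k))}"
  using ears[of "Suc k"] by (simp add: stage_def)

lemma stage_mono: "j \<le> k \<Longrightarrow> stage j \<subseteq> stage k"
  by (force simp: stage_def)

lemma arc_subset_D: "k \<in> {1..n} \<Longrightarrow> path_image (\<gamma> k) \<subseteq> D"
  by (auto simp: stage_def)

lemma compact_stage: "k \<le> n \<Longrightarrow> compact (stage k)"
  unfolding stage_def by (intro compact_UN) (auto intro!: compact_arc_image arcs)

lemma compact_D: "compact D" and closed_D: "closed D"
  using compact_stage[of n] compact_imp_closed by auto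

lemma path_connected_stage: "1 \<le> k \<Longrightarrow> k \<le> n \<Longrightarrow> path_connected (stage k)"
proof (induction k rule: dec_induct)
  case base
  then show ?case using arcs[of 1] by (simp add: stage_def path_connected_path_image arc_imp_path)
next
  case (step k)
  have "path_connected (stage k \<union> path_image (\<gamma> (Suc k)))"
  proof (rule path_connected_Un)
    show "path_connected (path_image (\<gamma> (Suc k)))"
      using arcs[of "Suc k"] step by (simp add: path_connected_path_image arc_imp_path)
    show "stage k \<inter> path_image (\<gamma> (Suc k)) \<noteq> {}" using ear_stage[of k] step by auto
  qed (use step in auto)
  then show ?case by (simp add: stage_Suc)
qed

lemma stage_2: "stage 2 = path_image (\<gamma> 1) \<union> path_image (\<gamma> 2)"
proof -
  have "{1..2::nat} = {1,2}" by auto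
  then show ?thesis by (simp add: stage_def)
qed

lemma small_connected_complement_stage:
  "2 \<le> k \<Longrightarrow> k \<le> n \<Longrightarrow> a \<in> stage k \<Longrightarrow> small_connected_complement (stage k) a"
proof (induction k arbitrary: a rule: dec_induct)
  case base
  then show ?case using base_circle small_connected_complement_circle stage_2 by metis
next
  case (step k)
  have "small_connected_complement (stage k \<union> path_image (\<gamma> (Suc k))) a"
  proof (rule small_connected_complement_ear)
    show "compact (stage k)" using compact_stage step by simp
    show "connected (stage k)" using path_connected_stage[of k] step path_connected_imp_connected by simp
    show "arc (\<gamma> (Suc k))" using arcs step by simp
    show "path_image (\<gamma> (Suc k)) \<inter> stage k = {pathstart (\<gamma> (Suc k)), pathfinish (\<gamma> (Suc k))}"
      using ear_stage[of k] step by simp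
  qed (use step in \<open>auto simp: stage_Suc\<close>)
  then show ?case by (simp add: stage_Suc)
qed

lemma arc_in_Jordan_curve:
  assumes "k \<in> {1..n}"
  obtains c where "simple_path c" "pathfinish c = pathstart c"
    "path_image (\<gamma> k) \<subseteq> path_image c" "path_image c \<subseteq> D"
proof (cases "k \<le> 2")
  case True
  then have "path_image (\<gamma> k) \<subseteq> stage 2" using assms by (auto simp: stage_def)
  moreover have "stage 2 \<subseteq> D" using stage_mono two_le by simp
  ultimately show ?thesis using base_circle that by (metis stage_2)
next
  case False
  obtain j where j: "k = Suc j" "2 \<le> j"
    by (rule that[of "k - 1"]) (use False in auto)
  obtain c where "simple_path c" "pathfinish c = pathstart c"
    "path_image (\<gamma> k) \<subseteq> path_image c" "path_image c \<subseteq> stage j \<union> path_image (\<gamma> k)"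
    using ear_in_Jordan_curve[OF path_connected_stage[of j] arcs[of k]] ear_stage[of j] assms j by auto
  then show ?thesis using that stage_mono[of k n] assms j stage_Suc[of j]
    by (metis atLeastAtMost_iff order_trans)
qed

text \<open>The circle has two faces and every further arc adds at least one. Finiteness is a hypothesis
  because infinite sets have cardinality \<open>0\<close>; for the whole network it is \<open>finite_faces\<close>.\<close>

lemma card_components_stage:
  "2 \<le> k \<Longrightarrow> k \<le> n \<Longrightarrow> finite (components (- stage k)) \<Longrightarrow> k \<le> card (components (- stage k))"
proof (induction k rule: dec_induct)
  case base
  obtain c where c: "simple_path c" "pathfinish c = pathstart c" "path_image c = stage 2"
    using base_circle stage_2 by auto
  have "\<not> connected (- stage 2)" using Jordan_disconnected[OF c(1,2)] c(3) by simp
  then have "card (components (- stage 2)) \<noteq> 0" "card (components (- stage 2)) \<noteq> 1"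
  proof -
    have ne: "- stage 2 \<noteq> {}" using \<open>\<not> connected (- stage 2)\<close> by auto
    show "card (components (- stage 2)) \<noteq> 0" using base ne by (simp add: components_eq_empty)
    show "card (components (- stage 2)) \<noteq> 1"
    proof
      assume "card (components (- stage 2)) = 1"
      then obtain F where "components (- stage 2) = {F}" by (meson card_1_singletonE)
      then have "- stage 2 = F" "F \<in> components (- stage 2)" using Union_components[of "- stage 2"] by auto
      then show False using \<open>\<not> connected (- stage 2)\<close> in_components_connected by metis
    qed
  qed
  then show ?case by linarith
next
  case (step k)
  note less = card_components_ear[of "stage k" "\<gamma> (Suc k)"]
  have "finite (components (- stage k)) \<and> card (components (- stage k)) < card (components (- stage (Suc k)))"
    unfolding stage_Suc
    using less compact_stage[of k] path_connected_stage[of k] arcs[of "Suc k"] ear_stage[of k] step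
    by (simp add: stage_Suc)
  then show ?case using step by simp
qed

section \<open>Vertices and edges\<close>

definition V :: "complex set" where
  "V = (\<Union>k\<in>{1..n}. {pathstart (\<gamma> k), pathfinish (\<gamma> k)})"

definition vertex_times :: "nat \<Rightarrow> real set" where
  "vertex_times k = {t \<in> {0..1}. \<gamma> k t \<in> V}"

text \<open>An edge is the pair of the index of an arc and the time at which the edge starts; it ends at the
  next time at which the arc passes a vertex. Every vertex time except \<open>1\<close> starts an edge.\<close>

definition edges :: "(nat \<times> real) set" where
  "edges = (SIGMA k:{1..n}. vertex_times k - {1})"

definition next_time :: "nat \<times> real \<Rightarrow> real" where
  "next_time e = Min {t \<in> vertex_times (fst e). snd e < t}"

definition edge_start :: "nat \<times> real \<Rightarrow> complex" where
  "edge_start e = \<gamma> (fst e) (snd e)"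

definition edge_end :: "nat \<times> real \<Rightarrow> complex" where
  "edge_end e = \<gamma> (fst e) (next_time e)"

definition open_edge :: "nat \<times> real \<Rightarrow> complex set" where
  "open_edge e = \<gamma> (fst e) ` {snd e<..<next_time e}"

definition closed_edge :: "nat \<times> real \<Rightarrow> complex set" where
  "closed_edge e = \<gamma> (fst e) ` {snd e..next_time e}"

lemma finite_V: "finite V"
  by (auto simp: V_def)

lemma inj_arc: "k \<in> {1..n} \<Longrightarrow> inj_on (\<gamma> k) {0..1}"
  using arcs by (simp add: arc_def)

lemma finite_vertex_times: "k \<in> {1..n} \<Longrightarrow> finite (vertex_times k)"
proof -
  assume k: "k \<in> {1..n}"
  have "finite (\<gamma> k ` vertex_times k)" by (rule finite_subset[OF _ finite_V]) (auto simp: vertex_times_def)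
  moreover have "inj_on (\<gamma> k) (vertex_times k)" by (rule inj_on_subset[OF inj_arc[OF k]]) (auto simp: vertex_times_def)
  ultimately show ?thesis using finite_image_iff by blast
qed

lemma ends_in_vertex_times: "k \<in> {1..n} \<Longrightarrow> 0 \<in> vertex_times k \<and> 1 \<in> vertex_times k"
  by (auto simp: vertex_times_def V_def pathstart_def pathfinish_def)

lemma finite_edges: "finite edges"
  unfolding edges_def using finite_vertex_times by (intro finite_SigmaI) auto

text \<open>A later arc meets the earlier ones only in its own endpoints.\<close>

lemma common_point_in_V:
  assumes "j \<in> {1..n}" "k \<in> {1..n}" "j < k" "x \<in> path_image (\<gamma> j)" "x \<in> path_image (\<gamma> k)"
  shows "x = pathstart (\<gamma> k) \<or> x = pathfinish (\<gamma> k)" "x \<in> V"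
proof -
  have "x \<in> path_image (\<gamma> k) \<inter> (\<Union>i\<in>{1..k-1}. path_image (\<gamma> i))" using assms by force
  also have "\<dots> = {pathstart (\<gamma> k), pathfinish (\<gamma> k)}" using assms by (intro ears) auto
  finally show "x = pathstart (\<gamma> k) \<or> x = pathfinish (\<gamma> k)" by simp
  then show "x \<in> V" unfolding V_def using assms(2) by blast
qed

lemma V_subset_D: "V \<subseteq> D"
  using arc_subset_D by (force simp: V_def)

text \<open>An arc with \<open>m\<close> vertices in its interior consists of \<open>m + 1\<close> edges. Every vertex is interior to
  at most one arc, and the two ends of the first arc are interior to none, so all the numbers \<open>m\<close>
  add up to at most \<open>card V - 2\<close>.\<close>

lemma card_edges: "card edges + 2 \<le> card V + n"
proof -
  \<comment> \<open>The passages through a vertex in the interior of an arc.\<close>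
  let ?I = "SIGMA k:{1..n}. vertex_times k - {0,1}"
  let ?f = "\<lambda>(k,t). \<gamma> k t"
  have one: "1 \<in> {1..n}" using two_le by simp
  have ne: "\<gamma> k t \<noteq> pathstart (\<gamma> k)" "\<gamma> k t \<noteq> pathfinish (\<gamma> k)"
    if "k \<in> {1..n}" "t \<in> vertex_times k - {0,1}" for k t
    using inj_onD[OF inj_arc[OF that(1)], of t 0] inj_onD[OF inj_arc[OF that(1)], of t 1] that
    by (auto simp: vertex_times_def pathstart_def pathfinish_def)
  have im: "\<gamma> k t \<in> path_image (\<gamma> k)" if "t \<in> vertex_times k" for k t
    using that by (auto simp: vertex_times_def path_image_def)
  have inj: "inj_on ?f ?I"
  proof (rule inj_onI)
    fix p q assume p: "p \<in> ?I" and q: "q \<in> ?I" and eq: "?f p = ?f q"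
    obtain k t where kt: "p = (k,t)" "k \<in> {1..n}" "t \<in> vertex_times k - {0,1}" using p by blast
    obtain j s where js: "q = (j,s)" "j \<in> {1..n}" "s \<in> vertex_times j - {0,1}" using q by blast
    have e: "\<gamma> k t = \<gamma> j s" using eq kt js by simp
    have on: "\<gamma> k t \<in> path_image (\<gamma> k)" "\<gamma> k t \<in> path_image (\<gamma> j)"
      using im[of t k] im[of s j] kt js e by auto
    have "\<not> j < k" using common_point_in_V(1)[OF js(2) kt(2) _ on(2,1)] ne[OF kt(2,3)] by blast
    moreover have "\<not> k < j" using common_point_in_V(1)[OF kt(2) js(2) _ on] ne[OF js(2,3)] e by metis
    ultimately have "j = k" by simp
    then show "p = q" using inj_onD[OF inj_arc[OF kt(2)], of t s] e kt js by (auto simp: vertex_times_def)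
  qed
  have sub: "?f ` ?I \<subseteq> V - {pathstart (\<gamma> 1), pathfinish (\<gamma> 1)}"
  proof (rule image_subsetI)
    fix p assume "p \<in> ?I"
    then obtain k t where p: "p = (k,t)" and kt': "k \<in> {1..n}" "t \<in> vertex_times k - {0,1}" by blast
    then have kt: "k \<in> {1..n}" "t \<in> vertex_times k" "t \<notin> {0,1}" by auto
    have "\<gamma> k t \<notin> {pathstart (\<gamma> 1), pathfinish (\<gamma> 1)}"
    proof (cases "k = 1")
      case True then show ?thesis using ne[OF kt'] by simp
    next
      case False
      then have "1 < k" using kt by simp
      then have "\<gamma> k t \<notin> path_image (\<gamma> 1)"
        using common_point_in_V(1)[of 1 k "\<gamma> k t"] kt one im[of t k] ne[OF kt'] by blast
      then show ?thesis by auto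
    qed
    then show "?f p \<in> V - {pathstart (\<gamma> 1), pathfinish (\<gamma> 1)}" using kt p by (simp add: vertex_times_def)
  qed
  have fI: "finite ?I" using finite_vertex_times by (intro finite_SigmaI) auto
  have "card ?I = card (?f ` ?I)" using card_image[OF inj] by simp
  also have "\<dots> \<le> card (V - {pathstart (\<gamma> 1), pathfinish (\<gamma> 1)})"
    by (rule card_mono[OF _ sub]) (simp add: finite_V)
  also have "\<dots> = card V - 2"
  proof -
    have "{pathstart (\<gamma> 1), pathfinish (\<gamma> 1)} \<subseteq> V" using one unfolding V_def by blast
    moreover have "card {pathstart (\<gamma> 1), pathfinish (\<gamma> 1)} = 2"
      using arc_distinct_ends[OF arcs[OF one]] by auto
    ultimately show ?thesis using card_Diff_subset by (metis finite.emptyI finite_insert)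
  qed
  finally have I: "card ?I \<le> card V - 2" .
  have V2: "2 \<le> card V"
  proof -
    have "{pathstart (\<gamma> 1), pathfinish (\<gamma> 1)} \<subseteq> V" using one unfolding V_def by blast
    then have "card {pathstart (\<gamma> 1), pathfinish (\<gamma> 1)} \<le> card V" by (rule card_mono[OF finite_V])
    then show ?thesis using arc_distinct_ends[OF arcs[OF one]] by auto
  qed
  have "edges \<subseteq> ?I \<union> (\<lambda>k. (k,0)) ` {1..n}" by (auto simp: edges_def)
  then have "card edges \<le> card (?I \<union> (\<lambda>k. (k,0::real)) ` {1..n})"
    by (rule card_mono[rotated]) (use fI in blast)
  also have "\<dots> \<le> card ?I + card ((\<lambda>k. (k,0::real)) ` {1..n})" by (rule card_Un_le)
  also have "\<dots> \<le> card ?I + n" using card_image_le[of "{1..n}" "\<lambda>k. (k,0::real)"] by simp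
  finally show ?thesis using I V2 by linarith
qed

lemma next_time:
  assumes "e \<in> edges"
  shows "fst e \<in> {1..n}" "snd e \<in> vertex_times (fst e)" "next_time e \<in> vertex_times (fst e)" "snd e < next_time e"
    "0 \<le> snd e" "next_time e \<le> 1"
    "\<And>t. t \<in> vertex_times (fst e) \<Longrightarrow> snd e < t \<Longrightarrow> next_time e \<le> t"
proof -
  obtain k s where e: "e = (k,s)" "k \<in> {1..n}" "s \<in> vertex_times k" "s \<noteq> 1" using assms unfolding edges_def by (cases e) blast
  let ?T = "{t \<in> vertex_times k. s < t}"
  have fin: "finite ?T" using finite_vertex_times e by simp
  have "1 \<in> ?T" using e ends_in_vertex_times[of k] by (auto simp: vertex_times_def)
  then have "Min ?T \<in> ?T" using fin by (intro Min_in) auto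
  then show "fst e \<in> {1..n}" "snd e \<in> vertex_times (fst e)" "next_time e \<in> vertex_times (fst e)" "snd e < next_time e"
    "0 \<le> snd e" "next_time e \<le> 1"
    using e by (auto simp: next_time_def vertex_times_def)
  show "next_time e \<le> t" if "t \<in> vertex_times (fst e)" "snd e < t" for t
    using that fin e by (auto simp: next_time_def intro!: Min_le)
qed

lemma closed_edge_eq:
  assumes "e \<in> edges"
  shows "closed_edge e = insert (edge_start e) (insert (edge_end e) (open_edge e))"
proof -
  have "{snd e..next_time e} = insert (snd e) (insert (next_time e) {snd e<..<next_time e})"
    using next_time(4)[OF assms] by auto
  then show ?thesis by (simp add: closed_edge_def edge_start_def edge_end_def open_edge_def)
qed

lemma edge_ends_in_V: "e \<in> edges \<Longrightarrow> edge_start e \<in> V" "e \<in> edges \<Longrightarrow> edge_end e \<in> V"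
  using next_time(2,3)[of e] by (simp_all add: edge_start_def edge_end_def vertex_times_def)

lemma closed_edge_subset: "e \<in> edges \<Longrightarrow> closed_edge e \<subseteq> path_image (\<gamma> (fst e))"
  using next_time(5,6)[of e] by (auto simp: closed_edge_def path_image_def)

lemma closed_edge_subset_D: "e \<in> edges \<Longrightarrow> closed_edge e \<subseteq> D"
  using closed_edge_subset[of e] arc_subset_D next_time(1)[of e] by blast

lemma open_edge_subset_closed: "open_edge e \<subseteq> closed_edge e"
  by (auto simp: open_edge_def closed_edge_def)

lemma open_edge_notin_V: "e \<in> edges \<Longrightarrow> x \<in> open_edge e \<Longrightarrow> x \<notin> V"
proof
  assume e: "e \<in> edges" and x: "x \<in> open_edge e" "x \<in> V"
  then obtain t where t: "snd e < t" "t < next_time e" "x = \<gamma> (fst e) t" by (auto simp: open_edge_def)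
  then have "t \<in> vertex_times (fst e)" using x next_time[OF e] by (auto simp: vertex_times_def)
  then show False using next_time(7)[OF e] t by force
qed

lemma D_point_in_open_edge:
  assumes "x \<in> D" "x \<notin> V"
  obtains e where "e \<in> edges" "x \<in> open_edge e"
proof -
  obtain k t where kt: "k \<in> {1..n}" "t \<in> {0..1}" "x = \<gamma> k t"
    using assms(1) by (auto simp: stage_def path_image_def)
  let ?T = "{s \<in> vertex_times k. s < t}"
  have t: "t \<notin> vertex_times k" using kt assms by (simp add: vertex_times_def)
  then have "0 < t" "t < 1" using ends_in_vertex_times[OF kt(1)] kt(2) by (auto simp: less_le)
  then have "0 \<in> ?T" using ends_in_vertex_times[OF kt(1)] by simp
  moreover have fin: "finite ?T" using finite_vertex_times[OF kt(1)] by simp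
  ultimately have m: "Max ?T \<in> ?T" by (intro Max_in) auto
  define e where "e = (k, Max ?T)"
  have e: "e \<in> edges" using m kt \<open>t < 1\<close> by (auto simp: e_def edges_def)
  have "t < next_time e"
  proof (rule ccontr)
    assume "\<not> t < next_time e"
    moreover have "next_time e \<noteq> t" using next_time(3)[OF e] t by (auto simp: e_def)
    ultimately have "next_time e \<in> ?T" using next_time(3)[OF e] by (auto simp: e_def)
    then have "next_time e \<le> Max ?T" using fin by (intro Max_ge)
    then show False using next_time(4)[OF e] by (simp add: e_def)
  qed
  then have "x \<in> open_edge e" using m kt by (auto simp: open_edge_def e_def)
  then show ?thesis using that e by blast
qed

lemma open_edges_disjoint:
  assumes "e \<in> edges" "e' \<in> edges" "x \<in> open_edge e" "x \<in> open_edge e'"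
  shows "e = e'"
proof -
  have x: "x \<notin> V" using open_edge_notin_V assms by blast
  have im: "x \<in> path_image (\<gamma> (fst e))" "x \<in> path_image (\<gamma> (fst e'))"
    using assms closed_edge_subset open_edge_subset_closed by blast+
  note n = next_time[OF assms(1)] next_time[OF assms(2)]
  have k: "fst e = fst e'"
    using common_point_in_V(2)[of "fst e" "fst e'" x] common_point_in_V(2)[of "fst e'" "fst e" x] im x n
    by (meson linorder_neqE_nat)
  obtain t where t: "snd e < t" "t < next_time e" "x = \<gamma> (fst e) t" using assms by (auto simp: open_edge_def)
  obtain s where s: "snd e' < s" "s < next_time e'" "x = \<gamma> (fst e') s" using assms by (auto simp: open_edge_def)
  have "t = s" using inj_onD[OF inj_arc[of "fst e"], of t s] t s n k by auto
  then have "snd e = snd e'"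
    using n(7)[of "snd e'"] n(14)[of "snd e"] n(2) n(9) t s k by (metis linorder_less_linear not_le order_less_trans)
  then show ?thesis using k by (simp add: prod_eq_iff)
qed

lemma continuous_on_arc_segment:
  assumes "k \<in> {1..n}" "T \<subseteq> {0..1}"
  shows "continuous_on T (\<gamma> k)"
  using arcs[OF assms(1)] continuous_on_subset[OF _ assms(2), of "\<gamma> k"] by (simp add: arc_def path_def)

lemma edge_times_subset: "e \<in> edges \<Longrightarrow> {snd e..next_time e} \<subseteq> {0..1}"
  using next_time(5,6)[of e] by simp

lemma compact_closed_edge: "e \<in> edges \<Longrightarrow> compact (closed_edge e)"
  unfolding closed_edge_def
  by (intro compact_continuous_image continuous_on_arc_segment next_time(1) edge_times_subset) auto

lemma open_edge_connected:
  assumes "e \<in> edges"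
  shows "connected (open_edge e)"
  unfolding open_edge_def
proof (intro connected_continuous_image continuous_on_arc_segment next_time(1) assms)
  show "{snd e<..<next_time e} \<subseteq> {0..1}"
    using next_time(5,6)[OF assms] by auto
qed simp

lemma open_edge_nonempty: "e \<in> edges \<Longrightarrow> open_edge e \<noteq> {}"
  using next_time(4)[of e] by (simp add: open_edge_def)

lemma closed_edge_arc:
  assumes "e \<in> edges"
  obtains g where "arc g" "path_image g = closed_edge e" "pathstart g = edge_start e" "pathfinish g = edge_end e"
proof
  note n = next_time[OF assms]
  let ?g = "subpath (snd e) (next_time e) (\<gamma> (fst e))"
  show "arc ?g" using n arcs by (intro arc_subpath_arc) (auto simp: vertex_times_def)
  show "path_image ?g = closed_edge e" using n by (simp add: path_image_subpath closed_edge_def)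
  show "pathstart ?g = edge_start e" "pathfinish ?g = edge_end e"
    by (auto simp: edge_start_def edge_end_def)
qed

lemma edge_endpoint_closure:
  assumes "e \<in> edges"
  shows "closed_edge e \<subseteq> closure (open_edge e)"
proof -
  note n = next_time[OF assms]
  have "continuous_on {snd e..next_time e} (\<gamma> (fst e))"
    using continuous_on_arc_segment n(1) edge_times_subset[OF assms] by blast
  then have "continuous_on (closure {snd e<..<next_time e}) (\<gamma> (fst e))"
    using n(4) by simp
  then have "\<gamma> (fst e) ` closure {snd e<..<next_time e} \<subseteq> closure (open_edge e)"
    unfolding open_edge_def by (rule image_closure_subset) (auto intro: closure_subset[THEN subsetD])
  then show ?thesis using n(4) by (simp add: closed_edge_def)
qed

lemma vertex_has_edge:
  assumes "v \<in> V"
  obtains e where "e \<in> edges" "v = edge_start e \<or> v = edge_end e"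
proof -
  obtain k where k: "k \<in> {1..n}" "v = pathstart (\<gamma> k) \<or> v = pathfinish (\<gamma> k)"
    using assms by (auto simp: V_def)
  show ?thesis
  proof (cases "v = pathstart (\<gamma> k)")
    case True
    have "(k,0) \<in> edges" using k ends_in_vertex_times by (auto simp: edges_def)
    then show ?thesis using that[of "(k,0)"] True by (simp add: edge_start_def pathstart_def)
  next
    case False
    then have v: "v = \<gamma> k 1" using k by (simp add: pathfinish_def)
    let ?T = "vertex_times k - {1}"
    have "finite ?T" "0 \<in> ?T" using finite_vertex_times[OF k(1)] ends_in_vertex_times[OF k(1)] by auto
    then have m: "Max ?T \<in> ?T" "\<And>s. s \<in> ?T \<Longrightarrow> s \<le> Max ?T" by (auto intro!: Max_in simp del: Diff_iff)
    let ?e = "(k, Max ?T)"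
    have e: "?e \<in> edges" using m k by (auto simp: edges_def)
    have "next_time ?e = 1"
      using next_time(3,4)[OF e] m(2)[of "next_time ?e"] by fastforce
    then show ?thesis using that[OF e] v by (simp add: edge_end_def)
  qed
qed

lemma D_near_edge_point:
  assumes "x \<in> D" "x \<notin> V"
  obtains k \<epsilon> where "k \<in> {1..n}" "x \<in> path_image (\<gamma> k)" "0 < \<epsilon>" "D \<inter> ball x \<epsilon> \<subseteq> path_image (\<gamma> k)"
proof -
  obtain k where k: "k \<in> {1..n}" "x \<in> path_image (\<gamma> k)" using assms by (auto simp: stage_def)
  let ?C = "\<Union>j\<in>{1..n} - {k}. path_image (\<gamma> j)"
  have "closed ?C" by (intro closed_UN) (auto intro!: closed_arc_image arcs)
  moreover have "x \<notin> ?C"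
    using common_point_in_V(2)[of _ k x] common_point_in_V(2)[of k _ x] k assms by (auto simp: neq_iff)
  ultimately obtain \<epsilon> where "\<epsilon> > 0" "ball x \<epsilon> \<subseteq> - ?C" by (meson ComplI open_Compl open_contains_ball)
  then show ?thesis using that[of k \<epsilon>] k by (auto simp: stage_def subset_iff)
qed

section \<open>Faces\<close>

abbreviation "faces \<equiv> components (- D)"

lemma face_open: "F \<in> faces \<Longrightarrow> open F"
  using open_components[of "- D" F] closed_D by (simp add: open_Compl)

lemma same_face: "connected_component (- D) y z \<Longrightarrow> F \<in> faces \<Longrightarrow> y \<in> F \<Longrightarrow> z \<in> F"
  by (metis componentsE connected_component_eq mem_Collect_eq)

lemma face_connected_component: "F \<in> faces \<Longrightarrow> y \<in> F \<Longrightarrow> z \<in> F \<Longrightarrow> connected_component (- D) y z"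
  by (meson connected_component_def in_components_connected in_components_subset)

lemma faces_eq: "F \<in> faces \<Longrightarrow> F' \<in> faces \<Longrightarrow> x \<in> F \<Longrightarrow> x \<in> F' \<Longrightarrow> F = F'"
  using components_nonoverlap[of F "- D" F'] by blast

lemma face_of: "x \<notin> D \<Longrightarrow> \<exists>F\<in>faces. x \<in> F"
  using Union_components[of "- D"] by blast

lemma closure_face: "F \<in> faces \<Longrightarrow> closure F \<subseteq> F \<union> D"
proof
  fix x assume F: "F \<in> faces" and x: "x \<in> closure F"
  show "x \<in> F \<union> D"
  proof (rule ccontr)
    assume nx: "x \<notin> F \<union> D"
    then obtain G where G: "G \<in> faces" "x \<in> G" using face_of by blast
    then have "F \<inter> G \<noteq> {}" using x face_open[OF G(1)] open_Int_closure_eq_empty[of G F] by blast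
    then show False using components_nonoverlap[OF F G(1)] nx G by blast
  qed
qed

lemma face_D_disjoint: "F \<in> faces \<Longrightarrow> x \<in> F \<Longrightarrow> x \<notin> D"
  using in_components_subset[of F "- D"] by blast

text \<open>Near a point that is not a vertex, \<open>D\<close> consists of a piece of one arc, and hence of a piece of
  a Jordan curve inside \<open>D\<close>. The two faces are the ones that contain the two sides of this curve
  near the point; each side is locally connected there, so it lies in a single face.\<close>

lemma two_faces_at_edge_point:
  assumes "x \<in> D" "x \<notin> V"
  obtains F G \<delta> where "F \<in> faces" "G \<in> faces" "F \<noteq> G" "0 < \<delta>" "ball x \<delta> - D \<subseteq> F \<union> G"
    "D \<inter> ball x \<delta> \<subseteq> closure F" "D \<inter> ball x \<delta> \<subseteq> closure G"
proof -
  obtain k \<epsilon> where k: "k \<in> {1..n}" "x \<in> path_image (\<gamma> k)" "0 < \<epsilon>" "D \<inter> ball x \<epsilon> \<subseteq> path_image (\<gamma> k)"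
    using D_near_edge_point[OF assms] by blast
  obtain c where c: "simple_path c" "pathfinish c = pathstart c" "path_image (\<gamma> k) \<subseteq> path_image c" "path_image c \<subseteq> D"
    using arc_in_Jordan_curve[OF k(1)] by blast
  note J = Jordan_sides[OF c(1,2)]
  have xc: "x \<in> path_image c" using k c by auto
  have eq: "ball x \<epsilon> - path_image c = ball x \<epsilon> - D" using k c by auto
  obtain \<delta> where \<delta>: "0 < \<delta>" "\<delta> \<le> \<epsilon>"
    "\<And>y z. y \<in> ball x \<delta> \<Longrightarrow> z \<in> ball x \<delta> \<Longrightarrow> connected_component (- path_image c) y z \<Longrightarrow>
           connected_component (ball x \<epsilon> - path_image c) y z"
    using locally_connected_near[OF compact_simple_path_image[OF c(1)] small_connected_complement_circle[OF c(1,2) xc] k(3)]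
    by blast
  have conn: "connected_component (- D) y z"
    if "y \<in> ball x \<delta>" "z \<in> ball x \<delta>" "connected_component (- path_image c) y z" for y z
    using \<delta>(3)[OF that] unfolding eq by (rule connected_component_of_subset) auto
  have off: "y \<notin> D" if "y \<in> ball x \<delta>" "y \<notin> path_image c" for y
  proof -
    have "y \<in> ball x \<epsilon> - path_image c" using that \<delta>(2) by simp
    then show ?thesis unfolding eq by blast
  qed
  obtain p where p: "p \<in> inside (path_image c)" "p \<in> ball x \<delta>" using J(2)[OF xc \<delta>(1)] by blast
  obtain q where q: "q \<in> outside (path_image c)" "q \<in> ball x \<delta>" using J(3)[OF xc \<delta>(1)] by blast
  obtain F where F: "F \<in> faces" "p \<in> F" using face_of off p J(7) by blast
  obtain G where G: "G \<in> faces" "q \<in> G" using face_of off q J(8) by blast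
  have inF: "y \<in> F" if "y \<in> ball x \<delta>" "y \<in> inside (path_image c)" for y
    using conn[OF p(2) that(1) J(4)[OF p(1) that(2)]] same_face F by blast
  have inG: "y \<in> G" if "y \<in> ball x \<delta>" "y \<in> outside (path_image c)" for y
    using conn[OF q(2) that(1) J(5)[OF q(1) that(2)]] same_face G by blast
  show ?thesis
  proof (rule that[of F G \<delta>])
    show "F \<noteq> G"
    proof
      assume "F = G"
      then have "connected_component (- D) p q" using face_connected_component F G by blast
      then have "connected_component (- path_image c) p q"
        by (rule connected_component_of_subset) (use c in auto)
      then show False using J(1) p q by blast
    qed
    show "ball x \<delta> - D \<subseteq> F \<union> G" using inF inG J(6) c by blast
    have near: "y \<in> path_image c \<and> (\<exists>s>0. s \<le> r \<and> ball y s \<subseteq> ball x \<delta>)"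
      if y: "y \<in> D \<inter> ball x \<delta>" and r: "r > 0" for y r
    proof -
      have "y \<in> path_image c" using y off by blast
      moreover obtain s where s: "s > 0" "ball y s \<subseteq> ball x \<delta>"
        using y open_contains_ball[of "ball x \<delta>"] by blast
      have "ball y (min s r) \<subseteq> ball x \<delta>" using s(2) by auto
      then have "\<exists>s>0. s \<le> r \<and> ball y s \<subseteq> ball x \<delta>" using s(1) r by (intro exI[of _ "min s r"]) simp
      ultimately show ?thesis by blast
    qed
    show "D \<inter> ball x \<delta> \<subseteq> closure F"
    proof
      fix y assume y: "y \<in> D \<inter> ball x \<delta>"
      show "y \<in> closure F" unfolding closure_approachable
      proof (intro allI impI)
        fix r :: real assume "0 < r"
        with near[OF y] obtain s where s: "y \<in> path_image c" "s > 0" "s \<le> r" "ball y s \<subseteq> ball x \<delta>" by blast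
        then obtain z where "z \<in> inside (path_image c)" "z \<in> ball y s" using J(2) by blast
        then show "\<exists>z\<in>F. dist z y < r" using inF s by (intro bexI[of _ z]) (auto simp: dist_commute)
      qed
    qed
    show "D \<inter> ball x \<delta> \<subseteq> closure G"
    proof
      fix y assume y: "y \<in> D \<inter> ball x \<delta>"
      show "y \<in> closure G" unfolding closure_approachable
      proof (intro allI impI)
        fix r :: real assume "0 < r"
        with near[OF y] obtain s where s: "y \<in> path_image c" "s > 0" "s \<le> r" "ball y s \<subseteq> ball x \<delta>" by blast
        then obtain z where "z \<in> outside (path_image c)" "z \<in> ball y s" using J(3) by blast
        then show "\<exists>z\<in>G. dist z y < r" using inG s by (intro bexI[of _ z]) (auto simp: dist_commute)
      qed
    qed
  qed (use F G \<delta> in auto)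
qed

lemma edge_point_closure_faces:
  assumes "x \<in> D" "x \<notin> V" "F \<in> faces" "x \<in> closure F" "ball x \<delta> - D \<subseteq> G \<union> H"
    "G \<in> faces" "H \<in> faces" "0 < \<delta>"
  shows "F = G \<or> F = H"
proof -
  obtain y where "y \<in> F" "dist y x < \<delta>" using assms(4,8) closure_approachable[of x F] by blast
  then have "y \<in> ball x \<delta> - D" using in_components_subset[OF assms(3)] by (auto simp: dist_commute)
  then show ?thesis using assms \<open>y \<in> F\<close> faces_eq by blast
qed

text \<open>By the previous lemmas the points of an open edge that border on \<open>F\<close> form an open and closed
  subset of it.\<close>

lemma open_edge_closure_face:
  assumes "e \<in> edges" "F \<in> faces" "x \<in> open_edge e" "x \<in> closure F"
  shows "closed_edge e \<subseteq> closure F"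
proof -
  have "open_edge e \<subseteq> closure F"
  proof -
    let ?A = "open_edge e \<inter> closure F"
    have "closedin (top_of_set (open_edge e)) ?A" by (simp add: closedin_closed_Int)
    moreover have "openin (top_of_set (open_edge e)) ?A"
      unfolding openin_contains_ball
    proof (intro conjI ballI)
      fix y assume y: "y \<in> ?A"
      have yD: "y \<in> D" "y \<notin> V" using y assms open_edge_notin_V closed_edge_subset_D open_edge_subset_closed by blast+
      obtain G H \<delta> where G: "G \<in> faces" "H \<in> faces" "G \<noteq> H" "0 < \<delta>" "ball y \<delta> - D \<subseteq> G \<union> H"
        "D \<inter> ball y \<delta> \<subseteq> closure G" "D \<inter> ball y \<delta> \<subseteq> closure H"
        using two_faces_at_edge_point[OF yD] by blast
      have "F = G \<or> F = H" using edge_point_closure_faces[OF yD assms(2) _ G(5) G(1,2,4)] y by blast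
      then have "D \<inter> ball y \<delta> \<subseteq> closure F" using G by blast
      then show "\<exists>\<epsilon>>0. ball y \<epsilon> \<inter> open_edge e \<subseteq> ?A"
        using G(4) closed_edge_subset_D[OF assms(1)] open_edge_subset_closed by (intro exI[of _ \<delta>]) blast
    qed auto
    ultimately have "?A = {} \<or> ?A = open_edge e"
      using open_edge_connected[OF assms(1)] unfolding connected_clopen by blast
    then show ?thesis using assms by blast
  qed
  then have "closure (open_edge e) \<subseteq> closure F" by (simp add: closure_minimal)
  then show ?thesis using edge_endpoint_closure[OF assms(1)] by blast
qed

text \<open>Otherwise the boundary of \<open>F\<close> would lie in the finite set \<open>V\<close>, whose complement is connected;
  then \<open>F\<close> would be all of this complement and leave no room for the edges.\<close>

lemma face_has_edge:
  assumes "F \<in> faces"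
  obtains e where "e \<in> edges" "open_edge e \<subseteq> closure F"
proof -
  have "\<exists>x. x \<in> D \<and> x \<notin> V \<and> x \<in> closure F"
  proof (rule ccontr)
    assume contra: "\<not> ?thesis"
    have conn: "connected (- V)"
      using connected_open_delete_finite[of "UNIV :: complex set" V] finite_V
      by (simp add: Compl_eq_Diff_UNIV connected_UNIV)
    note cl = closure_face[OF assms]
    have "F \<subseteq> - V" using in_components_subset[OF assms] V_subset_D by blast
    moreover have "openin (top_of_set (- V)) F"
      using face_open[OF assms] \<open>F \<subseteq> - V\<close> by (simp add: openin_open_eq finite_V finite_imp_closed open_Compl)
    moreover have "closedin (top_of_set (- V)) F"
    proof -
      have "F = - V \<inter> closure F" using cl contra \<open>F \<subseteq> - V\<close> closure_subset[of F] by blast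
      then show ?thesis by (metis closedin_closed_Int closed_closure)
    qed
    ultimately have "F = {} \<or> F = - V" using conn unfolding connected_clopen by blast
    then have "F = - V" using in_components_nonempty[OF assms] by blast
    then have "D \<subseteq> V" using in_components_subset[OF assms] by blast
    obtain v where "v \<in> V" using two_le unfolding V_def by fastforce
    then obtain e where e: "e \<in> edges" using vertex_has_edge by blast
    then obtain x where "x \<in> open_edge e" using open_edge_nonempty by blast
    then show False using \<open>D \<subseteq> V\<close> open_edge_notin_V[OF e] closed_edge_subset_D[OF e] open_edge_subset_closed by blast
  qed
  then obtain x where x: "x \<in> D" "x \<notin> V" "x \<in> closure F" by blast
  obtain e where "e \<in> edges" "x \<in> open_edge e" using D_point_in_open_edge[OF x(1,2)] by blast
  then show ?thesis using that open_edge_closure_face[OF _ assms] x open_edge_subset_closed by blast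
qed

text \<open>Every face borders on some edge, and every edge borders on at most two faces.\<close>

lemma finite_faces: "finite faces"
proof -
  define p where "p e = (SOME x. x \<in> open_edge e)" for e
  have p: "p e \<in> open_edge e" if "e \<in> edges" for e
    unfolding p_def using open_edge_nonempty[OF that] by (simp add: some_in_eq)
  have "finite {F \<in> faces. p e \<in> closure F}" if "e \<in> edges" for e
  proof -
    have pe: "p e \<in> D" "p e \<notin> V"
      using p[OF that] open_edge_notin_V[OF that] closed_edge_subset_D[OF that] open_edge_subset_closed by blast+
    obtain G H \<delta> where G: "G \<in> faces" "H \<in> faces" "0 < \<delta>" "ball (p e) \<delta> - D \<subseteq> G \<union> H"
      using two_faces_at_edge_point[OF pe] by metis
    have "{F \<in> faces. p e \<in> closure F} \<subseteq> {G, H}"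
      using edge_point_closure_faces[OF pe _ _ G(4) G(1,2,3)] by blast
    then show ?thesis by (rule finite_subset) simp
  qed
  then have "finite (\<Union>e\<in>edges. {F \<in> faces. p e \<in> closure F})" using finite_edges by blast
  moreover have "faces \<subseteq> (\<Union>e\<in>edges. {F \<in> faces. p e \<in> closure F})"
  proof
    fix F assume F: "F \<in> faces"
    obtain e where "e \<in> edges" "open_edge e \<subseteq> closure F" using face_has_edge[OF F] by blast
    then show "F \<in> (\<Union>e\<in>edges. {F \<in> faces. p e \<in> closure F})" using p F by blast
  qed
  ultimately show ?thesis by (rule finite_subset[rotated])
qed

text \<open>Euler's formula for the network, as the inequality needed here.\<close>

lemma card_edges_less: "card edges + 2 \<le> card V + card faces"
  using card_edges card_components_stage[of n] two_le finite_faces by simp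

end

section \<open>Functions with closed graph near the boundary of a face\<close>

locale discontinuity_network = ear_network +
  fixes g :: "complex \<Rightarrow> real"
  assumes closed_graph: "closed (range (\<lambda>x. (x, g x)))"
    and nonneg: "0 \<le> g x"
    and disc: "x \<in> D \<longleftrightarrow> \<not> isCont g x"
begin

definition graph_over :: "complex set \<Rightarrow> (complex \<times> real) set" where
  "graph_over S = (\<lambda>x. (x, g x)) ` S"

lemma closed_graph_over: "closed S \<Longrightarrow> closed (graph_over S)"
proof -
  assume "closed S"
  then have "closed (range (\<lambda>x. (x, g x)) \<inter> S \<times> UNIV)"
    by (intro closed_Int closed_graph closed_Times closed_UNIV)
  moreover have "range (\<lambda>x. (x, g x)) \<inter> S \<times> UNIV = graph_over S" by (auto simp: graph_over_def)
  ultimately show ?thesis by simp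
qed

text \<open>The closed graph has a positive distance from the compact set \<open>{a} \<times> T\<close>.\<close>

lemma values_avoid_compact:
  assumes "compact T" "g a \<notin> T"
  obtains \<delta> where "0 < \<delta>" "\<And>x. x \<in> ball a \<delta> \<Longrightarrow> g x \<notin> T"
proof -
  have "compact ({a} \<times> T)" using assms by (intro compact_Times) auto
  moreover have "({a} \<times> T) \<inter> range (\<lambda>x. (x, g x)) = {}" using assms by auto
  ultimately have "\<exists>d>0. \<forall>p\<in>{a} \<times> T. \<forall>q\<in>range (\<lambda>x. (x, g x)). d \<le> dist p q"
    by (intro separate_compact_closed closed_graph)
  then obtain d where d: "d > 0" "\<forall>p\<in>{a} \<times> T. \<forall>q\<in>range (\<lambda>x. (x, g x)). d \<le> dist p q" by blast
  have "g x \<notin> T" if "x \<in> ball a d" for x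
  proof
    assume "g x \<in> T"
    then have "d \<le> dist (a, g x) (x, g x)" using d(2) by blast
    then show False using that by (simp add: dist_Pair_Pair)
  qed
  then show ?thesis by (rule that[OF d(1)])
qed

text \<open>Closedness of the graph leaves only \<open>g a\<close> and infinity as accumulation values at \<open>a\<close>.\<close>

lemma bounded_imp_tendsto:
  assumes "0 < \<delta>" "\<And>x. x \<in> S \<Longrightarrow> x \<in> ball a \<delta> \<Longrightarrow> g x \<le> M"
  shows "(g \<longlongrightarrow> g a) (at a within S)"
  unfolding Lim_within
proof (intro allI impI)
  fix \<epsilon> :: real assume e: "0 < \<epsilon>"
  let ?T = "{0..M} - ball (g a) \<epsilon>"
  have "compact ?T" by (intro compact_diff) auto
  moreover have "g a \<notin> ?T" using e by simp
  ultimately obtain d where d: "0 < d" "\<And>x. x \<in> ball a d \<Longrightarrow> g x \<notin> ?T"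
    using values_avoid_compact by blast
  show "\<exists>d>0. \<forall>x\<in>S. 0 < dist x a \<and> dist x a < d \<longrightarrow> dist (g x) (g a) < \<epsilon>"
  proof (intro exI conjI ballI impI)
    show "0 < min d \<delta>" using d assms by simp
    fix x assume "x \<in> S" "0 < dist x a \<and> dist x a < min d \<delta>"
    then have "x \<in> ball a d" "g x \<le> M" using assms(2)[of x] by (auto simp: dist_commute)
    then show "dist (g x) (g a) < \<epsilon>" using d(2)[of x] nonneg[of x] by (auto simp: dist_commute)
  qed
qed

lemma tendsto_imp_bounded:
  assumes "(g \<longlongrightarrow> g a) (at a within S)" "a \<notin> S" "0 < \<epsilon>"
  obtains \<delta> where "0 < \<delta>" "\<And>x. x \<in> S \<Longrightarrow> x \<in> ball a \<delta> \<Longrightarrow> \<bar>g x - g a\<bar> < \<epsilon>"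
proof -
  obtain \<delta> where d: "0 < \<delta>" "\<forall>x\<in>S. 0 < dist x a \<and> dist x a < \<delta> \<longrightarrow> dist (g x) (g a) < \<epsilon>"
    using assms(1,3) unfolding Lim_within by blast
  show ?thesis
  proof (rule that[OF d(1)])
    fix x assume "x \<in> S" "x \<in> ball a \<delta>"
    moreover from this have "x \<noteq> a" using assms(2) by blast
    ultimately have "dist (g x) (g a) < \<epsilon>" using d(2) by (simp add: dist_commute[of a x])
    then show "\<bar>g x - g a\<bar> < \<epsilon>" by (simp add: dist_real_def)
  qed
qed

lemma continuous_on_off_D: "T \<inter> D = {} \<Longrightarrow> continuous_on T g"
  using disc by (intro continuous_at_imp_continuous_on) blast

text \<open>Near \<open>a\<close> the function omits some value \<open>m\<close> above \<open>g a\<close> and above \<open>M\<close>. Points of \<open>F\<close> near \<open>a\<close> can be joined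
  within \<open>F\<close> close to \<open>a\<close>, where \<open>g\<close> is continuous; as some value there is below \<open>m\<close>, all of them
  are, by the intermediate value theorem.\<close>

lemma face_limit_dichotomy:
  assumes a: "a \<in> D" and F: "F \<in> faces"
    and freq: "\<And>\<delta>. 0 < \<delta> \<Longrightarrow> \<exists>x\<in>F \<inter> ball a \<delta>. g x \<le> M"
  shows "(g \<longlongrightarrow> g a) (at a within F)"
proof -
  define m where "m = max M (g a) + 1"
  have "compact {m}" "g a \<notin> {m}" by (auto simp: m_def)
  then obtain \<epsilon> where \<epsilon>: "0 < \<epsilon>" "\<And>x. x \<in> ball a \<epsilon> \<Longrightarrow> g x \<notin> {m}"
    using values_avoid_compact by blast
  obtain \<delta> where \<delta>: "0 < \<delta>" "\<delta> \<le> \<epsilon>"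
    "\<And>y z. y \<in> ball a \<delta> \<Longrightarrow> z \<in> ball a \<delta> \<Longrightarrow> connected_component (- D) y z \<Longrightarrow>
           connected_component (ball a \<epsilon> - D) y z"
    using locally_connected_near[OF compact_D small_connected_complement_stage[OF two_le order_refl a] \<epsilon>(1)]
    by blast
  obtain y where y: "y \<in> F" "y \<in> ball a \<delta>" "g y \<le> M" using freq[OF \<delta>(1)] by blast
  show ?thesis
  proof (rule bounded_imp_tendsto[OF \<delta>(1)])
    fix x assume x: "x \<in> F" "x \<in> ball a \<delta>"
    obtain T where T: "connected T" "T \<subseteq> ball a \<epsilon> - D" "y \<in> T" "x \<in> T"
      using \<delta>(3)[OF y(2) x(2) face_connected_component[OF F y(1) x(1)]] by (auto simp: connected_component_def)
    have "connected (g ` T)"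
      using T by (intro connected_continuous_image continuous_on_off_D) auto
    moreover have "g y \<in> g ` T" "g x \<in> g ` T" using T by auto
    moreover have "m \<notin> g ` T" using \<epsilon>(2) T(2) by blast
    moreover have "g y \<le> m" using y by (simp add: m_def)
    ultimately show "g x \<le> m" using connectedD_interval by (metis linorder_le_cases)
  qed
qed

text \<open>The points at which \<open>g\<close> restricted to \<open>F\<close> extends continuously by its own value; at the other
  boundary points of \<open>F\<close> it tends to infinity, by \<open>face_limit_dichotomy\<close>.\<close>

definition tame :: "complex set \<Rightarrow> complex set" where
  "tame F = {a \<in> D. a \<in> closure F \<and> (g \<longlongrightarrow> g a) (at a within F)}"

lemma tame_subset: "tame F \<subseteq> D" "tame F \<subseteq> closure F"
  by (auto simp: tame_def)

text \<open>Boundedness of \<open>g\<close> on \<open>F\<close> near \<open>a\<close> makes the nearby boundary points tame as well, and the bound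
  passes to them by continuity. So the tame points are open in the boundary of \<open>F\<close>.\<close>

lemma tame_near:
  assumes F: "F \<in> faces" and a: "a \<in> tame F"
  obtains \<delta> where "0 < \<delta>" "D \<inter> closure F \<inter> ball a \<delta> \<subseteq> tame F"
    "\<And>x. x \<in> F \<union> (D \<inter> closure F) \<Longrightarrow> x \<in> ball a \<delta> \<Longrightarrow> g x \<le> g a + 1"
proof -
  have "a \<notin> F" using a tame_subset face_D_disjoint[OF F] by blast
  then obtain \<delta> where d: "0 < \<delta>" "\<And>x. x \<in> F \<Longrightarrow> x \<in> ball a \<delta> \<Longrightarrow> \<bar>g x - g a\<bar> < 1"
    using tendsto_imp_bounded[of a F 1] a by (auto simp: tame_def)
  have b: "b \<in> tame F \<and> g b \<le> g a + 1" if bD: "b \<in> D" and bF: "b \<in> closure F" and ba: "b \<in> ball a \<delta>" for b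
  proof -
    obtain r where r: "r > 0" "ball b r \<subseteq> ball a \<delta>" using ba open_contains_ball[of "ball a \<delta>"] by blast
    have le: "g x \<le> g a + 1" if "x \<in> F" "x \<in> ball b r" for x
    proof -
      have "\<bar>g x - g a\<bar> < 1" using d(2)[of x] that r by blast
      then show ?thesis by linarith
    qed
    have lim: "(g \<longlongrightarrow> g b) (at b within F)" using bounded_imp_tendsto[OF r(1)] le by blast
    have "b \<notin> F" using bD face_D_disjoint[OF F] by blast
    have "g b \<le> g a + 1"
    proof (rule ccontr)
      assume "\<not> ?thesis"
      then obtain s where s: "0 < s" "\<And>x. x \<in> F \<Longrightarrow> x \<in> ball b s \<Longrightarrow> \<bar>g x - g b\<bar> < g b - (g a + 1)"
        using tendsto_imp_bounded[OF lim \<open>b \<notin> F\<close>, of "g b - (g a + 1)"] by auto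
      obtain x where "x \<in> F" "dist x b < min r s"
        using bF closure_approachable[of b F] r(1) s(1) by (metis min_less_iff_conj)
      then show False using s(2)[of x] le[of x] by (simp add: dist_commute)
    qed
    then show ?thesis using bD bF lim by (simp add: tame_def)
  qed
  show ?thesis
  proof (rule that[OF d(1)])
    show "D \<inter> closure F \<inter> ball a \<delta> \<subseteq> tame F" using b by blast
    show "g x \<le> g a + 1" if "x \<in> F \<union> (D \<inter> closure F)" "x \<in> ball a \<delta>" for x
      using that b[of x] d(2)[of x] by fastforce
  qed
qed

text \<open>Tame points can be approximated from \<open>F\<close> together with their values. A limit point of the graph
  over \<open>F\<close> and its tame points thus lies over a point at which \<open>g\<close> does not tend to infinity within
  \<open>F\<close>, and such a boundary point is tame.\<close>

lemma closed_graph_face: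
  assumes F: "F \<in> faces"
  shows "closed (graph_over (F \<union> tame F))"
  unfolding closed_sequential_limits
proof (intro allI impI, elim conjE)
  fix p l assume p: "\<forall>n. p n \<in> graph_over (F \<union> tame F)" and lim: "p \<longlonglongrightarrow> l"
  have "l \<in> range (\<lambda>x. (x, g x))"
    using closed_sequentially[OF closed_graph _ lim] p unfolding graph_over_def by blast
  then obtain x where x: "l = (x, g x)" by auto
  have near: "\<exists>y\<in>F \<inter> ball x \<delta>. g y \<le> g x + 1" if \<delta>: "0 < \<delta>" for \<delta>
  proof -
    let ?r = "min (\<delta>/2) (1/2)"
    have "0 < ?r" using \<delta> by simp
    then obtain N where "dist (p N) l < ?r" using metric_LIMSEQ_D[OF lim] by blast
    moreover obtain z where z: "z \<in> F \<union> tame F" "p N = (z, g z)" using p unfolding graph_over_def by blast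
    ultimately have d: "dist z x < ?r" "dist (g z) (g x) < ?r"
      using dist_fst_le[of "p N" l] dist_snd_le[of "p N" l] x by auto
    show ?thesis
    proof (cases "z \<in> F")
      case True
      have "g z \<le> g x + 1" using d(2) unfolding dist_real_def by linarith
      then show ?thesis using True d(1) \<delta> by (intro bexI[of _ z]) (auto simp: dist_commute)
    next
      case False
      then have zQ: "z \<in> tame F" using z by blast
      then obtain s where s: "0 < s" "\<And>y. y \<in> F \<Longrightarrow> y \<in> ball z s \<Longrightarrow> \<bar>g y - g z\<bar> < 1/2"
        using tendsto_imp_bounded[of z F "1/2"] False by (auto simp: tame_def)
      obtain y where y: "y \<in> F" "dist y z < min s (\<delta>/2)"
        using tame_subset zQ closure_approachable[of z F] s(1) by (metis \<delta> half_gt_zero min_less_iff_conj subsetD)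
      have "dist y x < \<delta>" using dist_triangle[of y x z] y d by simp
      moreover have "\<bar>g y - g z\<bar> < 1/2" using s(2)[of y] y by (simp add: dist_commute)
      moreover have "\<bar>g z - g x\<bar> < 1/2" using d(2) by (simp add: dist_real_def)
      ultimately have "y \<in> F \<inter> ball x \<delta>" "g y \<le> g x + 1"
        using y(1) by (simp add: dist_commute, linarith)
      then show ?thesis by blast
    qed
  qed
  have cl: "x \<in> closure F" unfolding closure_approachable
  proof (intro allI impI)
    fix \<epsilon> :: real assume "0 < \<epsilon>"
    from near[OF this] show "\<exists>y\<in>F. dist y x < \<epsilon>" by (auto simp: dist_commute)
  qed
  have "x \<in> F \<union> tame F"
  proof (cases "x \<in> D")
    case True
    then show ?thesis using face_limit_dichotomy[OF True F near] cl by (simp add: tame_def)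
  next
    case False
    then show ?thesis using closure_face[OF F] cl by blast
  qed
  then show "l \<in> graph_over (F \<union> tame F)" using x by (auto simp: graph_over_def)
qed

text \<open>Otherwise \<open>g\<close> would be bounded near \<open>a\<close> and therefore continuous at \<open>a\<close>.\<close>

lemma not_all_sides_tame:
  assumes fin: "finite \<F>" "\<F> \<subseteq> faces" and tame: "\<And>F. F \<in> \<F> \<Longrightarrow> a \<in> tame F"
    and cover: "0 < \<delta>" "ball a \<delta> \<subseteq> (\<Union>F\<in>\<F>. F \<union> (D \<inter> closure F))"
  shows "a \<notin> D"
proof
  assume a: "a \<in> D"
  have "\<exists>\<epsilon>>0. \<forall>x. x \<in> F \<union> (D \<inter> closure F) \<longrightarrow> x \<in> ball a \<epsilon> \<longrightarrow> g x \<le> g a + 1" if "F \<in> \<F>" for F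
  proof -
    have "F \<in> faces" using fin that by blast
    then show ?thesis by (rule tame_near[OF _ tame[OF that]]) blast
  qed
  then obtain \<epsilon> where \<epsilon>: "\<And>F. F \<in> \<F> \<Longrightarrow> 0 < \<epsilon> F"
    "\<And>F x. F \<in> \<F> \<Longrightarrow> x \<in> F \<union> (D \<inter> closure F) \<Longrightarrow> x \<in> ball a (\<epsilon> F) \<Longrightarrow> g x \<le> g a + 1" by metis
  define r where "r = Min (insert \<delta> (\<epsilon> ` \<F>))"
  have r: "0 < r" "r \<le> \<delta>" "\<And>F. F \<in> \<F> \<Longrightarrow> r \<le> \<epsilon> F"
    using fin cover(1) \<epsilon>(1) by (auto simp: r_def)
  have "(g \<longlongrightarrow> g a) (at a)"
  proof (rule bounded_imp_tendsto[OF r(1)])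
    fix x assume x: "x \<in> ball a r"
    then have "x \<in> ball a \<delta>" using r(2) by simp
    then obtain F where F: "F \<in> \<F>" "x \<in> F \<union> (D \<inter> closure F)" using cover by blast
    then show "g x \<le> g a + 1" using \<epsilon>(2)[OF F] x r(3)[OF F(1)] by simp
  qed
  then show False using a disc by (simp add: isCont_def)
qed

text \<open>Exactly two faces meet near such a point, and they cannot both be tame there.\<close>

lemma one_tame_side:
  assumes "x \<notin> V" "F \<in> faces" "G \<in> faces" "x \<in> tame F" "x \<in> tame G"
  shows "F = G"
proof (rule ccontr)
  assume ne: "F \<noteq> G"
  have x: "x \<in> D" "x \<in> closure F" "x \<in> closure G" using assms tame_subset by blast+
  obtain A B \<delta> where A: "A \<in> faces" "B \<in> faces" "A \<noteq> B" "0 < \<delta>" "ball x \<delta> - D \<subseteq> A \<union> B"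
    "D \<inter> ball x \<delta> \<subseteq> closure A" "D \<inter> ball x \<delta> \<subseteq> closure B"
    using two_faces_at_edge_point[OF x(1) assms(1)] by blast
  have "F = A \<or> F = B" "G = A \<or> G = B"
    using edge_point_closure_faces[OF x(1) assms(1) _ _ A(5,1,2,4)] assms x by blast+
  then have tame: "x \<in> tame A" "x \<in> tame B" using ne assms by auto
  have "x \<notin> D"
    by (rule not_all_sides_tame[of "{A,B}" x \<delta>]) (use A tame in auto)
  then show False using x by simp
qed

section \<open>Corners and edge ends\<close>

text \<open>An edge end is an edge with a Boolean that is true for its final end. A corner is a vertex that is
  tame for a face, with that face.\<close>

definition germs :: "((nat \<times> real) \<times> bool) set" where
  "germs = edges \<times> UNIV"

definition germ_vertex :: "(nat \<times> real) \<times> bool \<Rightarrow> complex" where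
  "germ_vertex c = (if snd c then edge_end (fst c) else edge_start (fst c))"

definition corner_germs :: "complex \<times> complex set \<Rightarrow> ((nat \<times> real) \<times> bool) set" where
  "corner_germs c = {h \<in> germs. germ_vertex h = fst c \<and> open_edge (fst h) \<subseteq> closure (snd c)}"

definition corners :: "(complex \<times> complex set) set" where
  "corners = {(v, F). v \<in> V \<and> F \<in> faces \<and> v \<in> tame F}"

lemma finite_germs: "finite germs"
  using finite_edges by (simp add: germs_def)

lemma finite_corners: "finite corners"
  by (rule finite_subset[of _ "V \<times> faces"]) (auto simp: corners_def finite_V finite_faces)

lemma D_near_vertex:
  assumes "v \<in> V"
  obtains \<epsilon> where "0 < \<epsilon>" "\<And>y. y \<in> V \<Longrightarrow> y \<in> ball v \<epsilon> \<Longrightarrow> y = v"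
    "\<And>e y. e \<in> edges \<Longrightarrow> y \<in> closed_edge e \<Longrightarrow> y \<in> ball v \<epsilon> \<Longrightarrow> v = edge_start e \<or> v = edge_end e"
proof -
  let ?C = "(V - {v}) \<union> (\<Union>e\<in>{e \<in> edges. v \<notin> closed_edge e}. closed_edge e)"
  have "closed ?C"
    using finite_V finite_edges
    by (intro closed_Un closed_UN finite_imp_closed) (auto intro: compact_imp_closed compact_closed_edge)
  then have "open (- ?C)" by (rule open_Compl)
  moreover have "v \<in> - ?C" by blast
  ultimately obtain \<epsilon> where e: "0 < \<epsilon>" "ball v \<epsilon> \<subseteq> - ?C"
    using open_contains_ball[of "- ?C"] by blast
  show ?thesis
  proof (rule that[OF e(1)])
    show "y = v" if "y \<in> V" "y \<in> ball v \<epsilon>" for y using that e(2) by blast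
    show "v = edge_start e \<or> v = edge_end e" if "e \<in> edges" "y \<in> closed_edge e" "y \<in> ball v \<epsilon>" for e y
    proof -
      have "v \<in> closed_edge e" using that e(2) by blast
      then show ?thesis using closed_edge_eq[OF that(1)] open_edge_notin_V[OF that(1)] assms by blast
    qed
  qed
qed

lemma small_connected_complement_edge_end:
  assumes "e \<in> edges" "v = edge_start e \<or> v = edge_end e"
  shows "small_connected_complement (closed_edge e) v"
proof -
  obtain h where h: "arc h" "path_image h = closed_edge e" "pathstart h = edge_start e" "pathfinish h = edge_end e"
    using closed_edge_arc[OF assms(1)] by blast
  show ?thesis
  proof (cases "v = edge_start e")
    case True
    then show ?thesis using small_connected_complement_arc_start[OF h(1)] h by simp
  next
    case False
    then show ?thesis using small_connected_complement_arc_start[of "reversepath h"] h assms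
      by (simp add: arc_reversepath)
  qed
qed

text \<open>If at most one edge at \<open>v\<close> bordered on \<open>F\<close>, then the boundary of \<open>F\<close> near \<open>v\<close> would lie in a single
  arc that ends at \<open>v\<close>. An arc does not separate the plane, not even locally at its end, so \<open>F\<close>
  would contain all points near \<open>v\<close> off this arc. Then all sides of \<open>v\<close> would be tame, which is
  impossible.\<close>

lemma two_le_card_corner_germs:
  assumes "c \<in> corners"
  shows "2 \<le> card (corner_germs c)"
proof (rule ccontr)
  obtain v F where c: "c = (v, F)" "v \<in> V" "F \<in> faces" "v \<in> tame F" using assms unfolding corners_def by blast
  have fin: "finite (corner_germs c)" by (rule finite_subset[OF _ finite_germs]) (auto simp: corner_germs_def)
  assume "\<not> ?thesis"
  then have "card (corner_germs c) = 0 \<or> card (corner_germs c) = 1" by linarith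
  then have few: "corner_germs c = {} \<or> (\<exists>h. corner_germs c = {h})"
    using fin card_1_singletonE by (metis card_0_eq)
  \<comment> \<open>An edge \<open>e0\<close> at \<open>v\<close> that contains all points of the boundary of \<open>F\<close> near \<open>v\<close>.\<close>
  have "\<exists>e0. e0 \<in> edges \<and> (v = edge_start e0 \<or> v = edge_end e0) \<and> (\<forall>h\<in>corner_germs c. fst h = e0)"
  proof (cases "corner_germs c = {}")
    case True
    obtain e1 where "e1 \<in> edges" "v = edge_start e1 \<or> v = edge_end e1"
      using vertex_has_edge[OF c(2)] by blast
    then show ?thesis using True by blast
  next
    case False
    then obtain h where h: "corner_germs c = {h}" using few by blast
    then have "h \<in> corner_germs c" by simp
    then have "fst h \<in> edges" "v = edge_start (fst h) \<or> v = edge_end (fst h)"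
      using c by (auto simp: corner_germs_def germs_def germ_vertex_def split: if_splits)
    then show ?thesis using h by (intro exI[of _ "fst h"]) simp
  qed
  then obtain e0 where e0: "e0 \<in> edges" "v = edge_start e0 \<or> v = edge_end e0"
    "\<And>h. h \<in> corner_germs c \<Longrightarrow> fst h = e0" by blast
  have e0_only: "e = e0" if "e \<in> edges" "v = edge_start e \<or> v = edge_end e" "open_edge e \<subseteq> closure F" for e
  proof -
    have "(e, v = edge_end e) \<in> corner_germs c"
      using that c by (auto simp: corner_germs_def germs_def germ_vertex_def)
    then show ?thesis using e0(3) by fastforce
  qed
  let ?S = "closed_edge e0"
  obtain \<epsilon> where \<epsilon>: "0 < \<epsilon>" "\<And>y. y \<in> V \<Longrightarrow> y \<in> ball v \<epsilon> \<Longrightarrow> y = v"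
    "\<And>e y. e \<in> edges \<Longrightarrow> y \<in> closed_edge e \<Longrightarrow> y \<in> ball v \<epsilon> \<Longrightarrow> v = edge_start e \<or> v = edge_end e"
    using D_near_vertex[OF c(2)] by blast
  have near: "y \<in> ?S" if yD: "y \<in> D" and "y \<in> closure F" "y \<in> ball v \<epsilon>" for y
  proof (cases "y \<in> V")
    case True
    then show ?thesis using \<epsilon>(2)[OF True that(3)] e0 closed_edge_eq by auto
  next
    case False
    obtain e where e: "e \<in> edges" "y \<in> open_edge e" using D_point_in_open_edge[OF yD False] by blast
    then have "open_edge e \<subseteq> closure F"
      using open_edge_closure_face[OF e(1) c(3) e(2) that(2)] open_edge_subset_closed by blast
    moreover have "v = edge_start e \<or> v = edge_end e"
      using \<epsilon>(3)[OF e(1) _ that(3)] e open_edge_subset_closed by blast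
    ultimately have "e = e0" using e0_only e by blast
    then show ?thesis using e open_edge_subset_closed by blast
  qed
  obtain \<delta> where \<delta>: "0 < \<delta>" "\<delta> \<le> \<epsilon>"
    "\<And>y z. y \<in> ball v \<delta> \<Longrightarrow> z \<in> ball v \<delta> \<Longrightarrow> connected_component (- ?S) y z \<Longrightarrow>
           connected_component (ball v \<epsilon> - ?S) y z"
    using locally_connected_near[OF compact_closed_edge[OF e0(1)] small_connected_complement_edge_end[OF e0(1,2)] \<epsilon>(1)]
    by blast
  have off_S: "connected (- ?S)"
  proof -
    obtain h where "arc h" "path_image h = ?S" using closed_edge_arc[OF e0(1)] by blast
    then show ?thesis using connected_arc_complement[of h] by simp
  qed
  have SD: "?S \<subseteq> D" using closed_edge_subset_D e0 by blast
  have "v \<in> closure F" using c tame_subset by blast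
  then obtain z where "z \<in> F" "dist z v < \<delta>" using closure_approachable[of v F] \<delta>(1) by blast
  then have z: "z \<in> F" "z \<in> ball v \<delta>" "z \<notin> ?S" using face_D_disjoint[OF c(3)] SD by (auto simp: dist_commute)
  have inF: "y \<in> F" if y: "y \<in> ball v \<delta>" "y \<notin> ?S" for y
  proof -
    have "connected_component (- ?S) z y"
      unfolding connected_component_def using off_S y z by blast
    then obtain T where T: "connected T" "T \<subseteq> ball v \<epsilon> - ?S" "z \<in> T" "y \<in> T"
      using \<delta>(3)[OF z(2) y(1)] by (auto simp: connected_component_def)
    have eq: "T \<inter> closure F = T \<inter> F"
      using closure_face[OF c(3)] near T(2) closure_subset[of F] by blast
    have "closedin (top_of_set T) (T \<inter> F)" unfolding eq[symmetric] by (simp add: closedin_closed_Int)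
    moreover have "openin (top_of_set T) (T \<inter> F)" using face_open[OF c(3)] by (simp add: openin_open_Int)
    ultimately have "T \<inter> F = {} \<or> T \<inter> F = T" using T(1) unfolding connected_clopen by blast
    then show ?thesis using T z by blast
  qed
  have "ball v \<delta> \<subseteq> F \<union> (D \<inter> closure F)"
  proof
    fix y assume y: "y \<in> ball v \<delta>"
    show "y \<in> F \<union> (D \<inter> closure F)"
    proof (cases "y \<in> ?S")
      case True
      then have yD: "y \<in> D" using SD by blast
      have "y \<in> closure F"
      proof (cases "y \<in> V")
        case True
        then have "y = v" using \<epsilon>(2) y \<delta>(2) by auto
        then show ?thesis using \<open>v \<in> closure F\<close> by simp
      next
        case False
        obtain G H \<eta> where G: "G \<in> faces" "0 < \<eta>" "D \<inter> ball y \<eta> \<subseteq> closure G"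
          using two_faces_at_edge_point[OF yD False] by metis
        then have yG: "y \<in> closure G" using yD by auto
        obtain r where r: "r > 0" "ball y r \<subseteq> ball v \<delta>" using y open_contains_ball[of "ball v \<delta>"] by blast
        obtain w where "w \<in> G" "dist w y < r" using closure_approachable[of y G] yG r(1) by blast
        moreover from this have "w \<in> ball y r" by (simp add: dist_commute)
        moreover from this have "w \<in> ball v \<delta>" using r(2) by blast
        ultimately have "w \<in> G" "w \<in> ball v \<delta>" "w \<notin> ?S"
          using face_D_disjoint[OF G(1)] SD by blast+
        then have "G = F" using inF faces_eq G(1) c(3) by blast
        then show ?thesis using yG by simp
      qed
      then show ?thesis using yD by blast
    qed (use inF y in blast)
  qed
  then have "v \<notin> D" by (intro not_all_sides_tame[of "{F}" v \<delta>]) (use c \<delta> in auto)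
  then show False using c V_subset_D by blast
qed

lemma corner_germ_near:
  assumes "c \<in> corners" "h \<in> corner_germs c"
  obtains \<delta> where "0 < \<delta>" "closed_edge (fst h) \<inter> ball (fst c) \<delta> \<subseteq> tame (snd c)"
proof -
  have e: "fst h \<in> edges" "fst c \<in> V" "snd c \<in> faces" "fst c \<in> tame (snd c)" "open_edge (fst h) \<subseteq> closure (snd c)"
    using assms by (auto simp: corner_germs_def germs_def corners_def)
  obtain \<delta> where d: "0 < \<delta>" "D \<inter> closure (snd c) \<inter> ball (fst c) \<delta> \<subseteq> tame (snd c)"
    using tame_near[OF e(3,4)] by metis
  obtain x where "x \<in> open_edge (fst h)" using open_edge_nonempty[OF e(1)] by blast
  then have "closed_edge (fst h) \<subseteq> closure (snd c)"
    using open_edge_closure_face[OF e(1,3)] e(5) by blast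
  then have "closed_edge (fst h) \<inter> ball (fst c) \<delta> \<subseteq> tame (snd c)"
    using d(2) closed_edge_subset_D[OF e(1)] by blast
  then show ?thesis using that d(1) by blast
qed

lemma germ_point_near:
  assumes "h \<in> germs" "0 < \<delta>"
  obtains x where "x \<in> open_edge (fst h)" "x \<in> ball (germ_vertex h) \<delta>"
proof -
  have e: "fst h \<in> edges" using assms by (auto simp: germs_def)
  have "germ_vertex h \<in> closed_edge (fst h)" using closed_edge_eq[OF e] by (simp add: germ_vertex_def)
  then have "germ_vertex h \<in> closure (open_edge (fst h))" using edge_endpoint_closure[OF e] by blast
  then obtain x where "x \<in> open_edge (fst h)" "dist x (germ_vertex h) < \<delta>"
    using closure_approachable[of _ "open_edge (fst h)"] assms(2) by blast
  then show ?thesis using that by (simp add: dist_commute)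
qed

text \<open>An edge end that belongs to two corners would consist, near the vertex, of points that are tame
  for both faces, against \<open>one_tame_side\<close>.\<close>

lemma corner_germs_disjoint:
  assumes "c \<in> corners" "d \<in> corners" "h \<in> corner_germs c" "h \<in> corner_germs d"
  shows "c = d"
proof -
  have h: "h \<in> germs" "germ_vertex h = fst c" "germ_vertex h = fst d" using assms by (auto simp: corner_germs_def)
  obtain \<delta>1 where 1: "0 < \<delta>1" "closed_edge (fst h) \<inter> ball (fst c) \<delta>1 \<subseteq> tame (snd c)"
    using corner_germ_near[OF assms(1,3)] by blast
  obtain \<delta>2 where 2: "0 < \<delta>2" "closed_edge (fst h) \<inter> ball (fst d) \<delta>2 \<subseteq> tame (snd d)"
    using corner_germ_near[OF assms(2,4)] by blast
  obtain x where x: "x \<in> open_edge (fst h)" "x \<in> ball (germ_vertex h) (min \<delta>1 \<delta>2)"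
    using germ_point_near[OF h(1), of "min \<delta>1 \<delta>2"] 1(1) 2(1) by auto
  then have "x \<in> tame (snd c)" "x \<in> tame (snd d)"
    using 1(2) 2(2) h open_edge_subset_closed[of "fst h"] by auto
  moreover have "x \<notin> V" using open_edge_notin_V x h by (auto simp: germs_def)
  moreover have "snd c \<in> faces" "snd d \<in> faces" using assms by (auto simp: corners_def)
  ultimately have "snd c = snd d" using one_tame_side by blast
  then show ?thesis using h by (simp add: prod_eq_iff)
qed

section \<open>Cutting the graph over an edge\<close>

text \<open>What remains of a closed edge when the tame points in its interior, which are coloured with
  their face, are taken away. The ends are kept even if they are tame; a colouring that
  respects corners gives them the colour of their faces.\<close>

definition rest :: "nat \<times> real \<Rightarrow> complex set" where
  "rest e = closed_edge e - (\<Union>F\<in>faces. open_edge e \<inter> tame F)"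

definition splits :: "nat \<times> real \<Rightarrow> bool" where
  "splits e \<longleftrightarrow> (\<exists>P P'. P \<union> P' = rest e \<and> P \<inter> P' = {} \<and> edge_start e \<in> P \<and> edge_end e \<in> P' \<and>
      closed (graph_over P) \<and> closed (graph_over P'))"

lemma edge_ends_in_rest: "e \<in> edges \<Longrightarrow> edge_start e \<in> rest e \<and> edge_end e \<in> rest e"
  using closed_edge_eq[of e] edge_ends_in_V[of e] open_edge_notin_V[of e] by (auto simp: rest_def)

text \<open>An edge with a tame point in its interior borders on that face along its whole length, so the
  tame points that are taken away form an open part of it.\<close>

lemma closed_rest:
  assumes e: "e \<in> edges"
  shows "closed (rest e)"
proof -
  have "open (- rest e)"
    unfolding open_contains_ball
  proof
    fix y assume y: "y \<in> - rest e"
    show "\<exists>r>0. ball y r \<subseteq> - rest e"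
    proof (cases "y \<in> closed_edge e")
      case False
      have "open (- closed_edge e)" using compact_closed_edge[OF e] compact_imp_closed by blast
      then obtain r where "r > 0" "ball y r \<subseteq> - closed_edge e" using False open_contains_ball[of "- closed_edge e"] by blast
      then show ?thesis by (auto simp: rest_def)
    next
      case True
      then obtain F where F: "F \<in> faces" "y \<in> open_edge e" "y \<in> tame F" using y by (auto simp: rest_def)
      have "y \<in> closure F" using F tame_subset by blast
      then have sub: "closed_edge e \<subseteq> closure F" using open_edge_closure_face[OF e F(1,2)] by blast
      obtain r where r: "0 < r" "D \<inter> closure F \<inter> ball y r \<subseteq> tame F" using tame_near[OF F(1,3)] by metis
      have "y \<notin> {edge_start e, edge_end e}" using open_edge_notin_V[OF e F(2)] edge_ends_in_V[OF e] by auto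
      then obtain s where s: "0 < s" "ball y s \<subseteq> - {edge_start e, edge_end e}"
        using open_contains_ball[of "- {edge_start e, edge_end e}"] by (auto simp: finite_imp_closed open_Compl)
      have "x \<notin> rest e" if "x \<in> ball y (min r s)" for x
      proof
        assume x: "x \<in> rest e"
        then have "x \<in> closed_edge e" by (simp add: rest_def)
        moreover have "x \<noteq> edge_start e" "x \<noteq> edge_end e" using that s by auto
        ultimately have "x \<in> open_edge e" using closed_edge_eq[OF e] by blast
        moreover have "x \<in> tame F"
          using r(2) that \<open>x \<in> closed_edge e\<close> sub closed_edge_subset_D[OF e] by auto
        ultimately show False using x F(1) by (auto simp: rest_def)
      qed
      then show ?thesis using r s by (intro exI[of _ "min r s"]) auto
    qed
  qed
  then show ?thesis by (simp add: closed_def)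
qed

text \<open>A tame point in the interior of the edge leaves a gap in \<open>rest e\<close>, at which it can be cut.\<close>

lemma splits_at_tame_point:
  assumes e: "e \<in> edges" and F: "F \<in> faces" and x: "x \<in> open_edge e" "x \<in> tame F"
  shows "splits e"
proof -
  note n = next_time[OF e]
  obtain t where t: "snd e < t" "t < next_time e" "x = \<gamma> (fst e) t" using x by (auto simp: open_edge_def)
  let ?c = "\<gamma> (fst e)"
  let ?P = "rest e \<inter> ?c ` {snd e..t}" and ?P' = "rest e \<inter> ?c ` {t..next_time e}"
  have cl: "closed (?c ` {a..b})" if "0 \<le> a" "b \<le> 1" for a b
    using connected_path_segment(1)[OF arc_imp_path[OF arcs[OF n(1)]] that] compact_imp_closed by blast
  have "{snd e..next_time e} = {snd e..t} \<union> {t..next_time e}" using t by auto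
  then have "?P \<union> ?P' = rest e" by (auto simp: rest_def closed_edge_def)
  moreover have "?P \<inter> ?P' = {}"
  proof (rule ccontr)
    assume "?P \<inter> ?P' \<noteq> {}"
    then obtain w where w: "w \<in> rest e" "w \<in> ?c ` {snd e..t}" "w \<in> ?c ` {t..next_time e}" by blast
    then obtain a b where ab: "a \<in> {snd e..t}" "w = ?c a" "b \<in> {t..next_time e}" "w = ?c b" by blast
    have "a = b" using inj_onD[OF inj_arc[OF n(1)], of a b] ab t n(5,6) by auto
    then have "a = t" using ab by auto
    then have "x \<in> rest e" using w ab t by simp
    then show False using x F by (auto simp: rest_def)
  qed
  moreover have "edge_start e \<in> ?P" "edge_end e \<in> ?P'"
    using edge_ends_in_rest[OF e] t by (auto simp: edge_start_def edge_end_def)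
  moreover have "closed ?P" "closed ?P'"
    using closed_rest[OF e] cl[of "snd e" t] cl[of t "next_time e"] n t by (auto intro: closed_Int)
  ultimately show ?thesis unfolding splits_def
    by (intro exI[of _ ?P] exI[of _ ?P'] conjI closed_graph_over)
qed

definition linked :: "(nat \<times> real) set" where
  "linked = {e \<in> edges. \<not> splits e}"

lemma corner_germ_not_linked:
  assumes "c \<in> corners" "h \<in> corner_germs c"
  shows "fst h \<notin> linked"
proof -
  have h: "h \<in> germs" "germ_vertex h = fst c" "snd c \<in> faces"
    using assms by (auto simp: corner_germs_def corners_def)
  obtain \<delta> where d: "0 < \<delta>" "closed_edge (fst h) \<inter> ball (fst c) \<delta> \<subseteq> tame (snd c)"
    using corner_germ_near[OF assms] by blast
  obtain x where x: "x \<in> open_edge (fst h)" "x \<in> ball (germ_vertex h) \<delta>"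
    using germ_point_near[OF h(1) d(1)] by blast
  then have "x \<in> tame (snd c)" using d(2) h open_edge_subset_closed[of "fst h"] by auto
  then have "splits (fst h)" using splits_at_tame_point[OF _ h(3) x(1)] h by (auto simp: germs_def)
  then show ?thesis by (simp add: linked_def)
qed

text \<open>Count edge ends: each corner takes at least two of them, a linked edge keeps its own two for
  itself, and there are two for every edge.\<close>

lemma card_constraints: "card corners + card linked \<le> card edges"
proof -
  have fin: "finite (corner_germs c)" for c
    by (rule finite_subset[OF _ finite_germs]) (auto simp: corner_germs_def)
  have "2 * card corners = (\<Sum>c\<in>corners. 2)" by simp
  also have "\<dots> \<le> (\<Sum>c\<in>corners. card (corner_germs c))"
    by (intro sum_mono two_le_card_corner_germs)
  also have "\<dots> = card (\<Union>c\<in>corners. corner_germs c)"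
    using fin finite_corners corner_germs_disjoint by (intro card_UN_disjoint[symmetric]) blast+
  also have "\<dots> \<le> card ((edges - linked) \<times> (UNIV :: bool set))"
  proof (rule card_mono)
    show "finite ((edges - linked) \<times> (UNIV :: bool set))" using finite_edges by simp
    show "(\<Union>c\<in>corners. corner_germs c) \<subseteq> (edges - linked) \<times> UNIV"
    proof
      fix h assume "h \<in> (\<Union>c\<in>corners. corner_germs c)"
      then obtain c where "c \<in> corners" "h \<in> corner_germs c" by blast
      then have "fst h \<notin> linked" "fst h \<in> edges"
        using corner_germ_not_linked by (auto simp: corner_germs_def germs_def)
      then show "h \<in> (edges - linked) \<times> UNIV" by (simp add: mem_Times_iff)
    qed
  qed
  also have "\<dots> = 2 * (card edges - card linked)"
    using card_Diff_subset[of linked edges] finite_edges finite_subset[of linked edges]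
    by (auto simp: card_cartesian_product linked_def card_UNIV_bool)
  finally have "card corners \<le> card edges - card linked" by simp
  moreover have "card linked \<le> card edges"
    by (rule card_mono[OF finite_edges]) (auto simp: linked_def)
  ultimately show ?thesis by linarith
qed

section \<open>Separating the graph\<close>

text \<open>The part of the plane that belongs to the colour class \<open>X\<close>. Vertices and faces are the two
  summands of the type of nodes, and \<open>P\<close> selects the part of each edge.\<close>

definition side :: "(complex + complex set) set \<Rightarrow> (nat \<times> real \<Rightarrow> complex set) \<Rightarrow> complex set" where
  "side X P = (\<Union>F\<in>{F \<in> faces. Inr F \<in> X}. F \<union> tame F) \<union> {v \<in> V. Inl v \<in> X} \<union> (\<Union>e\<in>edges. P e)"

lemma closed_graph_side:
  assumes "\<And>e. e \<in> edges \<Longrightarrow> closed (graph_over (P e))"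
  shows "closed (graph_over (side X P))"
proof -
  have eq: "graph_over (side X P) = (\<Union>F\<in>{F \<in> faces. Inr F \<in> X}. graph_over (F \<union> tame F)) \<union>
     graph_over {v \<in> V. Inl v \<in> X} \<union> (\<Union>e\<in>edges. graph_over (P e))"
    unfolding graph_over_def side_def image_Un image_UN ..
  have "closed (graph_over {v \<in> V. Inl v \<in> X})"
    unfolding graph_over_def using finite_V by (intro finite_imp_closed) simp
  then show ?thesis unfolding eq
    using finite_faces finite_edges closed_graph_face assms by (intro closed_Un closed_UN) auto
qed

lemma rest_cases:
  assumes "x \<in> rest e" "e \<in> edges"
  shows "x \<in> D" "x \<in> V \<Longrightarrow> x = edge_start e \<or> x = edge_end e"
    "F \<in> faces \<Longrightarrow> x \<in> tame F \<Longrightarrow> x \<in> V" "x \<in> V \<or> x \<in> open_edge e"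
  using assms closed_edge_subset_D[OF assms(2)] closed_edge_eq[OF assms(2)] open_edge_notin_V[OF assms(2)]
    edge_ends_in_V[OF assms(2)]
  by (auto simp: rest_def)

text \<open>Only an edge with ends of different colours has to be cut, and such an edge is not linked.\<close>

lemma edge_splitting:
  assumes e: "e \<in> edges" and X: "e \<in> linked \<Longrightarrow> Inl (edge_start e) \<in> X \<longleftrightarrow> Inl (edge_end e) \<in> X"
  shows "\<exists>P P'. P \<union> P' = rest e \<and> P \<inter> P' = {} \<and> closed (graph_over P) \<and> closed (graph_over P') \<and>
    (\<forall>v\<in>{edge_start e, edge_end e}. (if Inl v \<in> X then v \<in> P else v \<in> P'))"
proof -
  note ends = edge_ends_in_rest[OF e]
  have all: "closed (graph_over (rest e))" "closed (graph_over {})"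
    using closed_graph_over closed_rest[OF e] closed_empty by blast+
  consider "Inl (edge_start e) \<in> X" "Inl (edge_end e) \<in> X" | "Inl (edge_start e) \<notin> X" "Inl (edge_end e) \<notin> X"
    | "Inl (edge_start e) \<in> X" "Inl (edge_end e) \<notin> X" | "Inl (edge_start e) \<notin> X" "Inl (edge_end e) \<in> X"
    by blast
  then show ?thesis
  proof cases
    case 1
    then show ?thesis using all ends by (intro exI[of _ "rest e"] exI[of _ "{}"]) simp
  next
    case 2
    then show ?thesis using all ends by (intro exI[of _ "{}"] exI[of _ "rest e"]) simp
  next
    case 3
    then have "splits e" using X e by (auto simp: linked_def)
    then obtain P P' where "P \<union> P' = rest e" "P \<inter> P' = {}" "edge_start e \<in> P" "edge_end e \<in> P'"
      "closed (graph_over P)" "closed (graph_over P')" unfolding splits_def by blast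
    then show ?thesis using 3 by (intro exI[of _ P] exI[of _ P']) simp
  next
    case 4
    then have "splits e" using X e by (auto simp: linked_def)
    then obtain P P' where "P \<union> P' = rest e" "P \<inter> P' = {}" "edge_start e \<in> P" "edge_end e \<in> P'"
      "closed (graph_over P)" "closed (graph_over P')" unfolding splits_def by blast
    then show ?thesis using 4 by (intro exI[of _ P'] exI[of _ P]) (simp add: Un_commute Int_commute)
  qed
qed

text \<open>There are at least two fewer constraints than nodes.\<close>

lemma exists_colouring:
  obtains X where "X \<subseteq> Inl ` V \<union> Inr ` faces" "X \<noteq> {}" "X \<noteq> Inl ` V \<union> Inr ` faces"
    "\<forall>(v, F)\<in>corners. Inl v \<in> X \<longleftrightarrow> Inr F \<in> X"
    "\<forall>e\<in>linked. Inl (edge_start e) \<in> X \<longleftrightarrow> Inl (edge_end e) \<in> X"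
proof -
  let ?S = "Inl ` V \<union> Inr ` faces :: (complex + complex set) set"
  let ?R1 = "(\<lambda>(v,F). (Inl v, Inr F)) ` corners :: ((complex + complex set) \<times> (complex + complex set)) set"
  let ?R2 = "(\<lambda>e. (Inl (edge_start e), Inl (edge_end e))) ` linked :: ((complex + complex set) \<times> (complex + complex set)) set"
  have finL: "finite linked" by (rule finite_subset[OF _ finite_edges]) (auto simp: linked_def)
  have "card (?R1 \<union> ?R2) \<le> card ?R1 + card ?R2" by (rule card_Un_le)
  also have "\<dots> \<le> card corners + card linked"
    by (intro add_mono card_image_le finite_corners finL)
  also have "\<dots> \<le> card edges" by (rule card_constraints)
  finally have "card (?R1 \<union> ?R2) + 2 \<le> card V + card faces" using card_edges_less by linarith
  also have "\<dots> = card ?S"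
    using finite_V finite_faces by (subst card_Un_disjoint) (auto simp: card_image)
  finally have le: "card (?R1 \<union> ?R2) + 2 \<le> card ?S" .
  have fin: "finite ?S" "finite (?R1 \<union> ?R2)"
    using finite_V finite_faces finite_corners finL by auto
  have sub: "?R1 \<union> ?R2 \<subseteq> ?S \<times> ?S"
  proof (rule Un_least)
    show "?R1 \<subseteq> ?S \<times> ?S" by (auto simp: corners_def)
    show "?R2 \<subseteq> ?S \<times> ?S" using edge_ends_in_V by (auto simp: linked_def)
  qed
  from exists_proper_closed_class[OF fin sub le] obtain X where X: "X \<subseteq> ?S" "X \<noteq> {}" "X \<noteq> ?S"
    "\<forall>(x,y)\<in>?R1 \<union> ?R2. x \<in> X \<longleftrightarrow> y \<in> X" by (elim exE conjE) (rule that)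
  have "Inl v \<in> X \<longleftrightarrow> Inr F \<in> X" if "(v, F) \<in> corners" for v F
  proof -
    have "(Inl v, Inr F) \<in> ?R1" using that by force
    then show ?thesis using X(4) by blast
  qed
  moreover have "Inl (edge_start e) \<in> X \<longleftrightarrow> Inl (edge_end e) \<in> X" if "e \<in> linked" for e
  proof -
    have "(Inl (edge_start e), Inl (edge_end e)) \<in> ?R2" using that by blast
    then show ?thesis using X(4) by blast
  qed
  ultimately show ?thesis using that[OF X(1-3)] by blast
qed

text \<open>The two colour classes give closed parts of the graph. They cover it because every point off the
  faces and vertices is either tame for some face or in the rest of an edge. They are disjoint
  because a point that is not a vertex is tame for at most one face, and because the colours of
  the vertices agree with those of the faces for which they are tame.\<close>

theorem graph_not_connected: "\<not> connected (range (\<lambda>x. (x, g x)))"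
proof
  assume conn: "connected (range (\<lambda>x. (x, g x)))"
  obtain X where X: "X \<subseteq> Inl ` V \<union> Inr ` faces" "X \<noteq> {}" "X \<noteq> Inl ` V \<union> Inr ` faces"
    and Xc': "\<forall>(v, F)\<in>corners. Inl v \<in> X \<longleftrightarrow> Inr F \<in> X"
    and Xl': "\<forall>e\<in>linked. Inl (edge_start e) \<in> X \<longleftrightarrow> Inl (edge_end e) \<in> X"
    by (rule exists_colouring)
  have Xc: "Inl v \<in> X \<longleftrightarrow> Inr F \<in> X" if "(v, F) \<in> corners" for v F using Xc' that by blast
  have Xl: "Inl (edge_start e) \<in> X \<longleftrightarrow> Inl (edge_end e) \<in> X" if "e \<in> linked" for e using Xl' that by blast
  define good where "good e P P' \<longleftrightarrow> P \<union> P' = rest e \<and> P \<inter> P' = {} \<and>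
      closed (graph_over P) \<and> closed (graph_over P') \<and>
      (\<forall>v\<in>{edge_start e, edge_end e}. (if Inl v \<in> X then v \<in> P else v \<in> P'))" for e P P'
  have "\<exists>P P'. good e P P'" if "e \<in> edges" for e
    unfolding good_def by (rule edge_splitting[OF that]) (rule Xl)
  then have "\<forall>e. \<exists>p. e \<in> edges \<longrightarrow> good e (fst p) (snd p)" by auto
  from choice[OF this] obtain p where p: "\<forall>e. e \<in> edges \<longrightarrow> good e (fst (p e)) (snd (p e))" ..
  define P P' where "P e = fst (p e)" and "P' e = snd (p e)" for e
  have PP: "good e (P e) (P' e)" if "e \<in> edges" for e
    unfolding P_def P'_def using p that by blast
  have P: "P e \<union> P' e = rest e" "P e \<inter> P' e = {}" "closed (graph_over (P e))" "closed (graph_over (P' e))"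
    if "e \<in> edges" for e using PP[OF that] unfolding good_def by blast+
  have P_vertex: "v \<in> P e \<longleftrightarrow> Inl v \<in> X" "v \<in> P' e \<longleftrightarrow> Inl v \<notin> X"
    if "e \<in> edges" "v \<in> rest e" "v \<in> V" for e v
  proof -
    have "v \<in> {edge_start e, edge_end e}" using rest_cases(2)[OF that(2,1,3)] by blast
    then have "if Inl v \<in> X then v \<in> P e else v \<in> P' e" using PP[OF that(1)] unfolding good_def by blast
    then show "v \<in> P e \<longleftrightarrow> Inl v \<in> X" "v \<in> P' e \<longleftrightarrow> Inl v \<notin> X" using P(2)[OF that(1)] by (auto split: if_splits)
  qed
  let ?A = "side X P" and ?B = "side (- X) P'"
  have cover: "x \<in> ?A \<union> ?B" for x
  proof (cases "x \<in> D")
    case False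
    then obtain F where "F \<in> faces" "x \<in> F" using face_of by blast
    then show ?thesis by (cases "Inr F \<in> X") (auto simp: side_def)
  next
    case True
    show ?thesis
    proof (cases "x \<in> V")
      case True
      then show ?thesis by (auto simp: side_def)
    next
      case False
      obtain e where e: "e \<in> edges" "x \<in> open_edge e" using D_point_in_open_edge[OF True False] by blast
      show ?thesis
      proof (cases "\<exists>F\<in>faces. x \<in> tame F")
        case True
        then obtain F where "F \<in> faces" "x \<in> tame F" by blast
        then show ?thesis by (cases "Inr F \<in> X") (auto simp: side_def)
      next
        case False
        then have "x \<in> rest e" using e open_edge_subset_closed[of e] unfolding rest_def by blast
        then have "x \<in> P e \<or> x \<in> P' e" using P(1)[OF e(1)] by blast
        then show ?thesis using e(1) by (auto simp: side_def)
      qed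
    qed
  qed
  \<comment> \<open>The kinds of pieces of a side that a point can lie on, with the colour of each.\<close>
  have vertex_colour: "x \<in> side Y R \<longleftrightarrow> Inl x \<in> Y"
    if x: "x \<in> V" and Y: "Y = X \<and> R = P \<or> Y = - X \<and> R = P'" for x Y R
  proof
    assume "Inl x \<in> Y" then show "x \<in> side Y R" using x by (auto simp: side_def)
  next
    assume "x \<in> side Y R"
    then consider F where "F \<in> faces" "Inr F \<in> Y" "x \<in> F \<union> tame F" | "Inl x \<in> Y" | e where "e \<in> edges" "x \<in> R e"
      by (auto simp: side_def)
    then show "Inl x \<in> Y"
    proof cases
      case (1 F)
      then have "x \<in> tame F" using face_D_disjoint[OF 1(1)] V_subset_D x by blast
      then have "(x, F) \<in> corners" using 1 x by (simp add: corners_def)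
      then show ?thesis using Xc[of x F] 1 Y by auto
    next
      case (3 e)
      then have "x \<in> rest e" using P(1)[OF 3(1)] Y by blast
      then show ?thesis using P_vertex[OF 3(1) _ x] 3 Y by auto
    qed
  qed
  have disj: "?A \<inter> ?B = {}"
  proof (rule ccontr)
    assume "?A \<inter> ?B \<noteq> {}"
    then obtain x where xA: "x \<in> ?A" and xB: "x \<in> ?B" by blast
    show False
    proof (cases "x \<in> V")
      case True
      then show False using vertex_colour[OF True, of X P] vertex_colour[OF True, of "- X" P'] xA xB by auto
    next
      case xV: False
      have cases_side: "(\<exists>F\<in>faces. Inr F \<in> Y \<and> x \<in> F \<union> tame F) \<or> (\<exists>e\<in>edges. x \<in> R e)" if "x \<in> side Y R" for Y R
        using that xV by (auto simp: side_def)
      have no_mix: False if "F \<in> faces" "x \<in> F \<union> tame F" "e \<in> edges" "x \<in> rest e" for F e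
      proof -
        have "x \<in> D" using rest_cases(1)[OF that(4,3)] .
        then have "x \<in> tame F" using that face_D_disjoint by blast
        then show False using rest_cases(3)[OF that(4,3,1)] xV by blast
      qed
      have sub: "P e \<subseteq> rest e" "P' e \<subseteq> rest e" if "e \<in> edges" for e using P(1)[OF that] by auto
      consider F G where "F \<in> faces" "G \<in> faces" "Inr F \<in> X" "Inr G \<notin> X" "x \<in> F \<union> tame F" "x \<in> G \<union> tame G"
        | e d where "e \<in> edges" "d \<in> edges" "x \<in> P e" "x \<in> P' d"
        using cases_side[OF xA] cases_side[OF xB] no_mix sub by blast
      then show False
      proof cases
        case (1 F G)
        have "F = G"
        proof (cases "x \<in> D")
          case True
          then have "x \<in> tame F" "x \<in> tame G" using 1 face_D_disjoint by blast+
          then show ?thesis using one_tame_side[OF xV] 1 by blast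
        next
          case False
          then have "x \<in> F" "x \<in> G" using 1 tame_subset by blast+
          then show ?thesis using faces_eq 1 by blast
        qed
        then show False using 1 by blast
      next
        case (2 e d)
        have "x \<in> rest e" "x \<in> rest d" using 2 sub by blast+
        then have "x \<in> open_edge e" "x \<in> open_edge d" using rest_cases(4) 2 xV by blast+
        then have "e = d" using open_edges_disjoint 2 by blast
        then show False using 2 P(2) by blast
      qed
    qed
  qed
  have "graph_over ?A \<inter> graph_over ?B \<inter> range (\<lambda>x. (x, g x)) = {}"
    using disj by (auto simp: graph_over_def)
  moreover have "range (\<lambda>x. (x, g x)) \<subseteq> graph_over ?A \<union> graph_over ?B"
    using cover by (auto simp: graph_over_def)
  moreover have "closed (graph_over ?A)" "closed (graph_over ?B)"
    using closed_graph_side P(3,4) by blast+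
  ultimately have "graph_over ?A \<inter> range (\<lambda>x. (x, g x)) = {} \<or> graph_over ?B \<inter> range (\<lambda>x. (x, g x)) = {}"
    using connected_closedD[OF conn] by blast
  then have "?A = {} \<or> ?B = {}" by (auto simp: graph_over_def)
  moreover have "\<exists>x. x \<in> side Y R" if "s \<in> Y" "s \<in> Inl ` V \<union> Inr ` faces" for s Y R
  proof (cases s)
    case (Inl v)
    then have "v \<in> side Y R" using that by (auto simp: side_def)
    then show ?thesis ..
  next
    case (Inr F)
    then have F: "F \<in> faces" using that by auto
    then obtain x where "x \<in> F" using in_components_nonempty by blast
    then have "x \<in> side Y R" using that Inr F by (auto simp: side_def)
    then show ?thesis ..
  qed
  moreover obtain s where "s \<in> X" "s \<in> Inl ` V \<union> Inr ` faces" using X(1,2) by blast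
  moreover obtain s' where "s' \<in> - X" "s' \<in> Inl ` V \<union> Inr ` faces" using X(1,3) by blast
  ultimately show False by blast
qed

end

section \<open>Proper functions on \<open>\<sigma>\<close>-locally compact metrisable spaces\<close>

lemma countable_compact_neighbourhoods:
  assumes "locally_compact_space Y" "sigma_compact_space Y" "topspace Y \<noteq> {}"
  shows "\<exists>C :: nat \<Rightarrow> 'b set. (\<forall>n. compactin Y (C n)) \<and>
    (\<forall>y\<in>topspace Y. \<exists>n U. openin Y U \<and> y \<in> U \<and> U \<subseteq> C n)"
proof -
  obtain \<K> where "countable \<K> \<and> (\<forall>K\<in>\<K>. compactin Y K) \<and> \<Union>\<K> = topspace Y"
    using assms(2) unfolding sigma_compact_space_def ..
  then have K: "countable \<K>" "\<And>K. K \<in> \<K> \<Longrightarrow> compactin Y K" "\<Union>\<K> = topspace Y" by simp_all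
  let ?U = "{U. openin Y U \<and> (\<exists>C. compactin Y C \<and> U \<subseteq> C)}"
  have "\<exists>\<F>. finite \<F> \<and> \<F> \<subseteq> ?U \<and> K \<subseteq> \<Union>\<F>" if "K \<in> \<K>" for K
  proof (rule compactinD[OF K(2)[OF that]])
    show "K \<subseteq> \<Union>?U"
    proof
      fix y assume "y \<in> K"
      then have "y \<in> \<Union>\<K>" using that by blast
      then have "y \<in> topspace Y" unfolding K(3) .
      then obtain U C where "openin Y U" "compactin Y C" "y \<in> U" "U \<subseteq> C"
        using bspec[OF assms(1)[unfolded locally_compact_space_def], of y] by blast
      then show "y \<in> \<Union>?U" by blast
    qed
  qed blast
  then obtain \<F> where F: "\<And>K. K \<in> \<K> \<Longrightarrow> finite (\<F> K) \<and> \<F> K \<subseteq> ?U \<and> K \<subseteq> \<Union>(\<F> K)" by metis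
  define cmp where "cmp U = (SOME C. compactin Y C \<and> U \<subseteq> C)" for U
  have cmp: "compactin Y (cmp U) \<and> U \<subseteq> cmp U" if "U \<in> ?U" for U
  proof -
    have "\<exists>C. compactin Y C \<and> U \<subseteq> C" using that by blast
    then show ?thesis unfolding cmp_def by (rule someI_ex)
  qed
  let ?V = "\<Union>K\<in>\<K>. \<F> K"
  have V: "countable ?V" "?V \<subseteq> ?U"
  proof -
    show "countable ?V" using F by (intro countable_UN K(1) countable_finite) simp
    show "?V \<subseteq> ?U" using F by blast
  qed
  have ne: "cmp ` ?V \<noteq> {}"
  proof -
    obtain y where "y \<in> \<Union>\<K>" using assms(3) unfolding K(3) by blast
    then obtain K where "K \<in> \<K>" "y \<in> K" by blast
    then show ?thesis using F[of K] by blast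
  qed
  define C where "C = from_nat_into (cmp ` ?V)"
  have C: "range C = cmp ` ?V" unfolding C_def using ne V(1) by (intro range_from_nat_into) auto
  show ?thesis
  proof (intro exI[of _ C] conjI allI ballI)
    show "compactin Y (C n)" for n
    proof -
      have "C n \<in> cmp ` ?V" using C by blast
      then obtain U where "U \<in> ?V" "C n = cmp U" by blast
      then show ?thesis using cmp[of U] V(2) by auto
    qed
    show "\<exists>n U. openin Y U \<and> y \<in> U \<and> U \<subseteq> C n" if "y \<in> topspace Y" for y
    proof -
      have "y \<in> \<Union>\<K>" using that unfolding K(3) .
      then obtain K where "K \<in> \<K>" "y \<in> K" by blast
      then obtain U where U: "U \<in> ?V" "y \<in> U" using F[of K] by blast
      have "cmp U \<in> range C" unfolding C using U(1) by (rule imageI)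
      then obtain n where n: "cmp U = C n" by blast
      have "U \<in> ?U" using U(1) V(2) by (rule subsetD[rotated])
      then have "openin Y U" "U \<subseteq> C n" using cmp[of U] n by auto
      then show ?thesis using U(2) by blast
    qed
  qed
qed

text \<open>Let \<open>w y\<close> be the supremum of the radii \<open>r \<le> (1/2)^n\<close> for which the ball of radius \<open>r\<close> about \<open>y\<close>
  lies in \<open>C n\<close>. It is positive and \<open>1\<close>-Lipschitz. Where \<open>w\<close> exceeds a given \<open>e > 0\<close>, only the
  finitely many \<open>n\<close> with \<open>(1/2)^n > e\<close> can provide the radii, so all these points lie in a finite
  union of the compact sets \<open>C n\<close>. Hence \<open>1/w\<close> is proper.\<close>

lemma (in Metric_space) exists_proper_real_function:
  fixes C :: "nat \<Rightarrow> 'a set"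
  assumes C: "\<And>n. compactin mtopology (C n)"
    and nbhd: "\<And>y. y \<in> M \<Longrightarrow> \<exists>n U. openin mtopology U \<and> y \<in> U \<and> U \<subseteq> C n"
  shows "\<exists>\<rho> :: 'a \<Rightarrow> real. continuous_map mtopology euclideanreal \<rho> \<and> (\<forall>y\<in>M. 0 \<le> \<rho> y) \<and>
    (\<forall>t. compactin mtopology {y \<in> M. \<rho> y \<le> t})"
proof -
  define R where "R y = {r. 0 \<le> r \<and> (\<exists>n. r \<le> (1/2)^n \<and> mball y r \<subseteq> C n)}" for y
  define w where "w y = Sup (R y)" for y
  have R0: "0 \<in> R y" for y using mball_eq_empty[of y 0] by (auto simp: R_def intro!: exI[of _ 0])
  have R1: "r \<le> 1" if "r \<in> R y" for r y
    using that power_le_one[of "1/2::real"] by (force simp: R_def intro: order_trans)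
  have bdd: "bdd_above (R y)" for y using R1 by (meson bdd_aboveI)
  have w_ge: "r \<le> w y" if "r \<in> R y" for r y
    unfolding w_def by (rule cSup_upper[OF that bdd])
  have w_pos: "0 < w y" if y: "y \<in> M" for y
  proof -
    obtain n U where U: "openin mtopology U" "y \<in> U" "U \<subseteq> C n" using nbhd[OF y] by blast
    then obtain r where r: "r > 0" "mball y r \<subseteq> U" by (auto simp: openin_mtopology)
    let ?r = "min r ((1/2)^n)"
    have "mball y ?r \<subseteq> mball y r" by (rule mball_subset_concentric) simp
    then have "?r \<in> R y" using r U by (auto simp: R_def intro!: exI[of _ n])
    moreover have "0 < ?r" using r by simp
    ultimately show ?thesis using w_ge by (meson order_less_le_trans)
  qed
  have lip: "w y \<le> w z + d y z" if yz: "y \<in> M" "z \<in> M" for y z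
  proof -
    have "r \<le> w z + d y z" if r: "r \<in> R y" for r
    proof (cases "r \<le> d y z")
      case True
      then show ?thesis using w_ge[OF R0[of z]] by linarith
    next
      case False
      obtain n where n: "r \<le> (1/2)^n" "mball y r \<subseteq> C n" using r by (auto simp: R_def)
      have "mball z (r - d y z) \<subseteq> mball y r"
        by (rule mball_subset) (use yz commute[of z y] in auto)
      moreover have "r - d y z \<le> (1/2)^n" using n(1) nonneg[of y z] by linarith
      ultimately have "r - d y z \<in> R z"
        using n(2) False by (auto simp: R_def intro!: exI[of _ n])
      then show ?thesis using w_ge[of "r - d y z" z] by linarith
    qed
    then show ?thesis unfolding w_def using R0[of y] by (intro cSup_least) auto
  qed
  have cont: "continuous_map mtopology euclideanreal w"
    unfolding continuous_map_eq_topcontinuous_at topcontinuous_at_def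
  proof (intro ballI conjI allI impI)
    fix y V assume y: "y \<in> topspace mtopology" and V: "openin euclideanreal V \<and> w y \<in> V"
    then obtain e where e: "e > 0" "ball (w y) e \<subseteq> V" by (auto simp: open_contains_ball)
    have "w z \<in> V" if "z \<in> mball y e" for z
    proof -
      have "y \<in> M" "z \<in> M" "d y z < e" using that by auto
      then have "\<bar>w y - w z\<bar> < e" using lip[of y z] lip[of z y] commute[of y z] by linarith
      then show ?thesis using e by (auto simp: dist_real_def)
    qed
    then show "\<exists>U. openin mtopology U \<and> y \<in> U \<and> (\<forall>z\<in>U. w z \<in> V)"
      using y e by (intro exI[of _ "mball y e"]) auto
  qed auto
  define \<rho> where "\<rho> y = inverse (w y)" for y
  have cont': "continuous_map mtopology euclideanreal \<rho>"
    unfolding \<rho>_def using cont w_pos by (intro continuous_map_real_inverse) fastforce+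
  show ?thesis
  proof (intro exI[of _ \<rho>] conjI allI ballI cont')
    show "0 \<le> \<rho> y" if "y \<in> M" for y using w_pos[OF that] by (simp add: \<rho>_def)
    show "compactin mtopology {y \<in> M. \<rho> y \<le> t}" for t
    proof -
      have cl: "closedin mtopology {y \<in> M. \<rho> y \<le> t}"
        using closedin_continuous_map_preimage[OF cont', of "{..t}"] by simp
      \<comment> \<open>\<open>\<bar>t\<bar> + 1\<close> instead of \<open>t\<close> keeps the bound \<open>e\<close> positive and strictly below \<open>w\<close>.\<close>
      define e where "e = 1 / (\<bar>t\<bar> + 1)"
      have e: "e > 0" by (simp add: e_def)
      obtain N where N: "(1/2::real)^N < e" using real_arch_pow_inv[OF e, of "1/2"] by auto
      have "{y \<in> M. \<rho> y \<le> t} \<subseteq> (\<Union>n\<in>{..<N}. C n)"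
      proof
        fix y assume "y \<in> {y \<in> M. \<rho> y \<le> t}"
        then have y: "y \<in> M" "inverse (w y) \<le> t" by (auto simp: \<rho>_def)
        then have "inverse (w y) < \<bar>t\<bar> + 1" by linarith
        then have "e < w y" using w_pos[OF y(1)] by (simp add: e_def field_simps)
        then obtain r where r: "r \<in> R y" "e < r"
          unfolding w_def using less_cSupE[of e "R y"] R0[of y] by blast
        then obtain n where n: "r \<le> (1/2)^n" "mball y r \<subseteq> C n" by (auto simp: R_def)
        have "n < N"
        proof (rule ccontr)
          assume "\<not> n < N"
          then have "(1/2::real)^n \<le> (1/2)^N" by (intro power_decreasing) auto
          then show False using n r N by linarith
        qed
        moreover have "y \<in> C n" using n(2) r e y by (auto simp: subset_iff)
        ultimately show "y \<in> (\<Union>n\<in>{..<N}. C n)" by blast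
      qed
      moreover have "compactin mtopology (\<Union>n\<in>{..<N}. C n)"
        using C by (intro compactin_Union) auto
      ultimately show ?thesis using closed_compactin cl by blast
    qed
  qed
qed

lemma exists_proper_real_function:
  assumes "metrizable_space Y" "sigma_locally_compact_space Y"
  obtains \<rho> :: "'b \<Rightarrow> real" where "continuous_map Y euclideanreal \<rho>" "\<And>y. y \<in> topspace Y \<Longrightarrow> 0 \<le> \<rho> y"
    "\<And>t. compactin Y {y \<in> topspace Y. \<rho> y \<le> t}"
proof (cases "topspace Y = {}")
  case True
  then show ?thesis using that[of "\<lambda>_. 0"] by simp
next
  case False
  obtain M d where Y: "Metric_space M d" "Y = Metric_space.mtopology M d"
    using assms(1) unfolding metrizable_space_def by blast
  interpret Metric_space M d by (rule Y(1))
  have lc: "locally_compact_space Y" and sc: "sigma_compact_space Y"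
    using assms(2) by (simp_all add: sigma_locally_compact_space_def)
  from countable_compact_neighbourhoods[OF lc sc False] obtain C :: "nat \<Rightarrow> 'b set" where C: "\<forall>n. compactin Y (C n)"
    "\<forall>y\<in>topspace Y. \<exists>n U. openin Y U \<and> y \<in> U \<and> U \<subseteq> C n"
    by blast
  have "\<exists>\<rho> :: 'b \<Rightarrow> real. continuous_map mtopology euclideanreal \<rho> \<and> (\<forall>y\<in>M. 0 \<le> \<rho> y) \<and>
    (\<forall>t. compactin mtopology {y \<in> M. \<rho> y \<le> t})"
  proof (rule exists_proper_real_function[of C])
    show "compactin mtopology (C n)" for n using C(1) unfolding Y(2) ..
    show "\<exists>n U. openin mtopology U \<and> y \<in> U \<and> U \<subseteq> C n" if "y \<in> M" for y
      using bspec[OF C(2), of y] that unfolding Y(2) by simp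
  qed
  then obtain \<rho> :: "'b \<Rightarrow> real" where "continuous_map mtopology euclideanreal \<rho>" "\<forall>y\<in>M. 0 \<le> \<rho> y"
    "\<forall>t. compactin mtopology {y \<in> M. \<rho> y \<le> t}" by blast
  then show ?thesis by (intro that[of \<rho>]) (simp_all add: Y(2))
qed

lemma proper_map_real:
  assumes "continuous_map Y euclideanreal \<rho>" "\<And>t. compactin Y {y \<in> topspace Y. \<rho> y \<le> t}"
  shows "proper_map Y euclideanreal \<rho>"
proof (rule compact_imp_proper_map)
  show "k_space euclideanreal" by (simp add: metrizable_imp_k_space metrizable_space_euclidean)
  show "kc_space euclideanreal" by (simp add: Hausdorff_imp_kc_space)
  fix K :: "real set" assume "compactin euclideanreal K"
  then have K: "compact K" by simp
  then obtain t where t: "\<And>x. x \<in> K \<Longrightarrow> x \<le> t" using compact_imp_bounded[OF K] bounded_real by (meson abs_le_D1)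
  have "closedin Y {y \<in> topspace Y. \<rho> y \<in> K}"
    using closedin_continuous_map_preimage[OF assms(1), of K] K compact_imp_closed by auto
  then show "compactin Y {y \<in> topspace Y. \<rho> y \<in> K}"
    by (rule closed_compactin[OF assms(2)[of t], rotated]) (use t in auto)
qed (use assms in auto)

section \<open>Reduction to real-valued functions\<close>

text \<open>The product of the identity with a proper map is proper, hence closed.\<close>

lemma closed_real_graph:
  assumes \<rho>: "continuous_map Y euclideanreal \<rho>" "\<And>t. compactin Y {y \<in> topspace Y. \<rho> y \<le> t}"
    and f: "closedin (prod_topology euclidean Y) (fun_graph f)"
  shows "closed (range (\<lambda>x. (x, \<rho> (f x))))"
proof -
  have "proper_map (prod_topology euclidean Y) (prod_topology euclidean euclideanreal) (\<lambda>(x,y). (x :: real^2, \<rho> y))"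
    using proper_map_prod[of euclidean Y euclidean euclideanreal "\<lambda>x::real^2. x" \<rho>] proper_map_real[OF \<rho>] proper_map_id[of "euclidean :: (real^2) topology"]
    by (simp add: id_def)
  then have "closedin (prod_topology euclidean euclideanreal) ((\<lambda>(x,y). (x, \<rho> y)) ` fun_graph f)"
    using f proper_imp_closed_map closed_map_def by blast
  moreover have "(\<lambda>(x,y). (x, \<rho> y)) ` fun_graph f = range (\<lambda>x. (x, \<rho> (f x)))"
    by (auto simp: fun_graph_def image_image)
  ultimately show ?thesis by simp
qed

lemma connected_real_graph:
  assumes \<rho>: "continuous_map Y euclideanreal \<rho>" and f: "f \<in> UNIV \<rightarrow> topspace Y"
    and conn: "connected_space (subtopology (prod_topology euclidean Y) (fun_graph f))"
  shows "connected (range (\<lambda>x. (x, \<rho> (f x))))"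
proof -
  have "connectedin (prod_topology euclidean Y) (fun_graph f)"
    using conn f by (auto simp: connectedin_def fun_graph_def)
  moreover have "continuous_map (prod_topology (euclidean :: (real^2) topology) Y) (prod_topology euclidean euclideanreal) (\<lambda>p. (fst p, \<rho> (snd p)))"
    using continuous_map_compose[OF continuous_map_snd \<rho>, of "euclidean :: (real^2) topology"] continuous_map_fst[of "euclidean :: (real^2) topology" Y]
    by (intro continuous_map_pairedI) (simp_all add: comp_def)
  ultimately have "connectedin (prod_topology euclidean euclideanreal) ((\<lambda>p. (fst p, \<rho> (snd p))) ` fun_graph f)"
    using connectedin_continuous_map_image by blast
  moreover have "(\<lambda>p. (fst p, \<rho> (snd p))) ` fun_graph f = range (\<lambda>x. (x, \<rho> (f x)))"
    by (auto simp: fun_graph_def image_image)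
  ultimately show ?thesis by simp
qed

text \<open>Continuity of \<open>\<rho> \<circ> f\<close> at \<open>x\<close> confines the values of \<open>f\<close> near \<open>x\<close> to a compact set \<open>K\<close>. For an open
  \<open>V\<close> around \<open>f x\<close>, the tube lemma gives a neighbourhood of \<open>x\<close> over which the closed graph misses the
  compact set \<open>K - V\<close>; so \<open>f\<close> maps it into \<open>V\<close>.\<close>

lemma discontinuity_set_real:
  assumes \<rho>: "continuous_map Y euclideanreal \<rho>" "\<And>t. compactin Y {y \<in> topspace Y. \<rho> y \<le> t}"
    and Y: "metrizable_space Y"
    and f: "f \<in> UNIV \<rightarrow> topspace Y" "closedin (prod_topology euclidean Y) (fun_graph f)"
  shows "x \<in> discontinuity_set Y f \<longleftrightarrow> \<not> isCont (\<lambda>x. \<rho> (f x)) x"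
proof -
  have fY: "f z \<in> topspace Y" for z using f by auto
  have "isCont (\<lambda>x. \<rho> (f x)) x" if cont: "topcontinuous_at euclidean Y f x"
    unfolding continuous_at_open
  proof (intro allI impI)
    fix t assume t: "open t \<and> \<rho> (f x) \<in> t"
    have "openin Y {y \<in> topspace Y. \<rho> y \<in> t}"
      using openin_continuous_map_preimage[OF \<rho>(1), of t] t by simp
    moreover have "f x \<in> {y \<in> topspace Y. \<rho> y \<in> t}" using t fY by simp
    ultimately obtain U where "openin euclidean U" "x \<in> U" "\<forall>z\<in>U. f z \<in> {y \<in> topspace Y. \<rho> y \<in> t}"
      using cont unfolding topcontinuous_at_def by blast
    then show "\<exists>S. open S \<and> x \<in> S \<and> (\<forall>z\<in>S. \<rho> (f z) \<in> t)" by (intro exI[of _ U]) auto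
  qed
  moreover have "topcontinuous_at euclidean Y f x" if cont: "isCont (\<lambda>x. \<rho> (f x)) x"
    unfolding topcontinuous_at_def
  proof (intro conjI allI impI)
    fix V assume V: "openin Y V \<and> f x \<in> V"
    let ?K = "{y \<in> topspace Y. \<rho> y \<le> \<rho> (f x) + 1}"
    have "open {..<\<rho> (f x) + 1}" "\<rho> (f x) \<in> {..<\<rho> (f x) + 1}" by auto
    then obtain S where S: "open S" "x \<in> S" "\<forall>z\<in>S. \<rho> (f z) \<in> {..<\<rho> (f x) + 1}"
      using cont unfolding continuous_at_open by blast
    have K: "compactin Y ?K" by (rule \<rho>)
    have cmp: "compactin Y (?K - V)"
    proof (rule closed_compactin[OF K])
      have "closedin Y ?K" using K Y by (simp add: compactin_imp_closedin metrizable_imp_Hausdorff_space)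
      then show "closedin Y (?K - V)" using V by (intro closedin_diff) auto
    qed auto
    let ?O = "topspace (prod_topology euclidean Y) - fun_graph f"
    have opn: "openin (prod_topology euclidean Y) ?O"
      by (rule openin_diff[OF openin_topspace f(2)])
    have sub: "{x} \<times> (?K - V) \<subseteq> ?O"
      using V by (auto simp: fun_graph_def)
    obtain U W where U: "openin euclidean U" "x \<in> U" "?K - V \<subseteq> W" "U \<times> W \<subseteq> ?O"
      using tube_lemma_right[OF opn cmp _ sub] by auto
    have "f z \<in> V" if "z \<in> S \<inter> U" for z
    proof (rule ccontr)
      assume "f z \<notin> V"
      moreover have "f z \<in> ?K" using S(3) that fY[of z] by auto
      ultimately have "(z, f z) \<in> U \<times> W" using U(3) that by blast
      then show False using U(4) by (auto simp: fun_graph_def)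
    qed
    then show "\<exists>U. openin euclidean U \<and> x \<in> U \<and> (\<forall>z\<in>U. f z \<in> V)"
      using S U by (intro exI[of _ "S \<inter> U"]) auto
  qed (use fY in auto)
  ultimately show ?thesis unfolding discontinuity_set_def by blast
qed

lemma homeomorphic_circle_imp_simple_loop:
  fixes S :: "'a::t2_space set"
  assumes "S homeomorphic (sphere 0 1 :: (real^2) set)"
  obtains c where "simple_path c" "pathfinish c = pathstart c" "path_image c = S"
proof -
  have "(sphere 0 1 :: (real^2) set) homeomorphic (sphere 0 1 :: complex set)"
    by (rule homeomorphic_spheres_gen) auto
  then have "(sphere 0 1 :: complex set) homeomorphic S"
    using assms homeomorphic_sym homeomorphic_trans by blast
  then obtain q where q: "continuous_on (sphere (0::complex) 1) q" "q ` sphere 0 1 = S" "inj_on q (sphere 0 1)"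
    unfolding homeomorphic_def homeomorphism_def by (metis inj_on_inverseI)
  have im: "path_image (circlepath 0 1) = sphere 0 1" by simp
  have "simple_path (q \<circ> circlepath 0 1)"
    by (rule simple_path_continuous_image) (use q in \<open>simp_all add: simple_path_circlepath\<close>)
  moreover have "path_image (q \<circ> circlepath 0 1) = S" using q(2) im by (simp add: path_image_compose)
  ultimately show ?thesis using that[of "q \<circ> circlepath 0 1"] by (simp add: pathfinish_compose pathstart_compose)
qed

section \<open>Functions on the plane whose discontinuities form a network\<close>

theorem corollary46:
  fixes Y :: "'b topology" and f :: "real^2 \<Rightarrow> 'b"
  assumes "metrizable_space Y"
    and "sigma_locally_compact_space Y"
    and "f \<in> UNIV \<rightarrow> topspace Y"
    and "closedin (prod_topology euclidean Y) (fun_graph f)"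
    and "network (discontinuity_set Y f)"
  shows "\<not> connected_space (subtopology (prod_topology euclidean Y) (fun_graph f))"
proof
  assume conn: "connected_space (subtopology (prod_topology euclidean Y) (fun_graph f))"
  obtain \<rho> :: "'b \<Rightarrow> real" where \<rho>: "continuous_map Y euclideanreal \<rho>" "\<And>y. y \<in> topspace Y \<Longrightarrow> 0 \<le> \<rho> y"
    "\<And>t. compactin Y {y \<in> topspace Y. \<rho> y \<le> t}"
    using exists_proper_real_function[OF assms(1,2)] by blast
  obtain \<psi> :: "complex \<Rightarrow> real^2" and \<phi> where \<psi>: "homeomorphism UNIV UNIV \<psi> \<phi>"
    using homeomorphic_subspaces_eq[of "UNIV :: complex set" "UNIV :: (real^2) set"] unfolding homeomorphic_def by auto
  have inv: "\<phi> (\<psi> z) = z" "\<psi> (\<phi> x) = x" for z x using \<psi> by (auto simp: homeomorphism_def)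
  have c\<psi>: "continuous_on UNIV \<psi>" and c\<phi>: "continuous_on UNIV \<phi>" using \<psi> by (auto simp: homeomorphism_def)
  define g where "g z = \<rho> (f (\<psi> z))" for z
  obtain n :: nat and A a b where n: "2 \<le> n" "\<forall>i\<in>{1..n}. arc_between (A i) (a i) (b i)"
    "discontinuity_set Y f = (\<Union>i\<in>{1..n}. A i)"
    "(A 1 \<union> A 2) homeomorphic (sphere 0 1 :: (real^2) set)"
    "\<forall>k\<in>{2..n}. A k \<inter> (\<Union>i\<in>{1..k-1}. A i) = {a k, b k}"
    using assms(5) unfolding network_def by metis
  have "\<forall>i. \<exists>h. i \<in> {1..n} \<longrightarrow> (\<exists>k. homeomorphism {0..1::real} (A i) h k \<and> h 0 = a i \<and> h 1 = b i)"
    using n(2) unfolding arc_between_def by blast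
  from choice[OF this] obtain h where h:
    "\<forall>i. i \<in> {1..n} \<longrightarrow> (\<exists>k. homeomorphism {0..1::real} (A i) (h i) k \<and> h i 0 = a i \<and> h i 1 = b i)" ..
  have hi: "continuous_on {0..1} (h i)" "inj_on (h i) {0..1}" "h i ` {0..1} = A i" "h i 0 = a i" "h i 1 = b i"
    if i: "i \<in> {1..n}" for i
  proof -
    obtain k where k: "homeomorphism {0..1::real} (A i) (h i) k" "h i 0 = a i" "h i 1 = b i"
      using h i by blast
    show "h i 0 = a i" "h i 1 = b i" by (rule k)+
    show "continuous_on {0..1} (h i)" "h i ` {0..1} = A i" using k(1) unfolding homeomorphism_def by blast+
    show "inj_on (h i) {0..1}" using k(1) unfolding homeomorphism_def by (intro inj_on_inverseI[of _ k]) blast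
  qed
  define \<gamma> where "\<gamma> i = \<phi> \<circ> h i" for i
  have im: "path_image (\<gamma> i) = \<phi> ` A i" if "i \<in> {1..n}" for i
    unfolding \<gamma>_def path_image_def image_comp[symmetric] hi(3)[OF that] ..
  have inj\<phi>: "inj \<phi>" using inv by (metis injI)
  interpret ear_network n \<gamma>
  proof
    show "2 \<le> n" by (rule n)
    show "arc (\<gamma> k)" if k: "k \<in> {1..n}" for k
    proof -
      have "continuous_on {0..1} (\<phi> \<circ> h k)"
        using hi(1)[OF k] continuous_on_subset[OF c\<phi>] by (intro continuous_on_compose) auto
      moreover have "inj_on (\<phi> \<circ> h k) {0..1}"
        using hi(2)[OF k] inj\<phi> by (intro comp_inj_on) (auto intro: inj_on_subset)
      ultimately show ?thesis by (simp add: arc_def path_def \<gamma>_def)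
    qed
    show "\<exists>c. simple_path c \<and> pathfinish c = pathstart c \<and> path_image c = path_image (\<gamma> 1) \<union> path_image (\<gamma> 2)"
    proof -
      obtain c where c: "simple_path c" "pathfinish c = pathstart c" "path_image c = A 1 \<union> A 2"
        using homeomorphic_circle_imp_simple_loop[OF n(4)] by blast
      have "simple_path (\<phi> \<circ> c)"
        using c(1) continuous_on_subset[OF c\<phi>] inj_on_subset[OF inj\<phi>] by (intro simple_path_continuous_image) auto
      moreover have "path_image (\<phi> \<circ> c) = path_image (\<gamma> 1) \<union> path_image (\<gamma> 2)"
        using c(3) im n(1) by (simp add: path_image_compose image_Un)
      ultimately show ?thesis
        using c(2) by (intro exI[of _ "\<phi> \<circ> c"]) (simp add: pathfinish_compose pathstart_compose)
    qed
    show "path_image (\<gamma> k) \<inter> (\<Union>i\<in>{1..k-1}. path_image (\<gamma> i)) = {pathstart (\<gamma> k), pathfinish (\<gamma> k)}"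
      if k: "k \<in> {2..n}" for k
    proof -
      have k1: "k \<in> {1..n}" using k by simp
      have "(\<Union>i\<in>{1..k-1}. path_image (\<gamma> i)) = \<phi> ` (\<Union>i\<in>{1..k-1}. A i)"
        unfolding image_UN using im k by (intro SUP_cong) auto
      then have "path_image (\<gamma> k) \<inter> (\<Union>i\<in>{1..k-1}. path_image (\<gamma> i)) = \<phi> ` (A k \<inter> (\<Union>i\<in>{1..k-1}. A i))"
        using im[OF k1] inj\<phi> by (simp add: image_Int)
      also have "\<dots> = \<phi> ` {a k, b k}" using n(5) k by simp
      also have "\<dots> = {pathstart (\<gamma> k), pathfinish (\<gamma> k)}"
        using hi(4,5)[OF k1] by (simp add: \<gamma>_def pathstart_def pathfinish_def)
      finally show ?thesis .
    qed
  qed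
  interpret discontinuity_network n \<gamma> g
  proof
    have "continuous_on UNIV (\<lambda>p::complex \<times> real. (\<psi> (fst p), snd p))"
      by (intro continuous_intros continuous_on_compose2[OF c\<psi>]) auto
    then have "closed ((\<lambda>p. (\<psi> (fst p), snd p)) -` range (\<lambda>x. (x, \<rho> (f x))))"
      using closed_real_graph[OF \<rho>(1,3) assms(4)] by (intro closed_vimage)
    moreover have "(\<lambda>p. (\<psi> (fst p), snd p)) -` range (\<lambda>x. (x, \<rho> (f x))) = range (\<lambda>z. (z, g z))"
      by (auto simp: g_def image_iff)
    ultimately show "closed (range (\<lambda>z. (z, g z)))" by simp
    show "0 \<le> g z" for z using \<rho>(2) assms(3) by (auto simp: g_def)
    show "x \<in> D \<longleftrightarrow> \<not> isCont g x" for x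
    proof -
      have "isCont g x \<longleftrightarrow> isCont (\<lambda>x. \<rho> (f x)) (\<psi> x)"
      proof
        assume "isCont g x"
        then have "isCont (\<lambda>y. g (\<phi> y)) (\<psi> x)"
          using isCont_o2[of "\<psi> x" \<phi> g] c\<phi> inv by (simp add: continuous_on_eq_continuous_at)
        then show "isCont (\<lambda>x. \<rho> (f x)) (\<psi> x)" by (simp add: g_def inv)
      next
        assume "isCont (\<lambda>x. \<rho> (f x)) (\<psi> x)"
        then show "isCont g x" unfolding g_def
          using isCont_o2[of x \<psi> "\<lambda>x. \<rho> (f x)"] c\<psi> by (simp add: continuous_on_eq_continuous_at)
      qed
      moreover have "x \<in> D \<longleftrightarrow> \<psi> x \<in> discontinuity_set Y f"
      proof -
        have "D = \<phi> ` discontinuity_set Y f"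
          unfolding stage_def n(3) image_UN using im by (intro SUP_cong) auto
        then show ?thesis by (metis image_iff inv)
      qed
      ultimately show ?thesis
        using discontinuity_set_real[OF \<rho>(1,3) assms(1,3,4)] by simp
    qed
  qed
  have c\<phi>2: "continuous_on UNIV (\<lambda>p::(real^2) \<times> real. (\<phi> (fst p), snd p))"
    by (intro continuous_intros continuous_on_compose2[OF c\<phi>]) auto
  have "connected ((\<lambda>p. (\<phi> (fst p), snd p)) ` range (\<lambda>x. (x, \<rho> (f x))))"
    using connected_continuous_image[OF continuous_on_subset[OF c\<phi>2 subset_UNIV]
        connected_real_graph[OF \<rho>(1) assms(3) conn]] .
  moreover have "(\<lambda>p. (\<phi> (fst p), snd p)) ` range (\<lambda>x. (x, \<rho> (f x))) = range (\<lambda>z. (z, g z))"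
  proof -
    have "surj \<phi>" using inv by (metis surjI)
    then have "range (\<lambda>z. (z, g z)) = range (\<lambda>x. (\<phi> x, g (\<phi> x)))"
      using image_image[of "\<lambda>z. (z, g z)" \<phi> UNIV] by simp
    then show ?thesis by (simp add: image_image g_def inv)
  qed
  ultimately show False using graph_not_connected by simp
qed

end
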